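(* Let $0<\sigma<\tfrac12$ and define $w_\sigma:\mathbb{Z}\to(0,\infty)$ by $$w_\sigma(x)=4^\sigma\,\frac{\Gamma\left(\frac{1+2\sigma}{4}\right)^2}{\Gamma\left(\frac{1-2\sigma}{4}\right)^2}\cdot\frac{\Gamma\left(|x|+\frac{1-2\sigma}{4}\right)\Gamma\left(|x|+\frac{3-2\sigma}{4}\right)}{\Gamma\left(|x|+\frac{3+2\sigma}{4}\right)\Gamma\left(|x|+\frac{1+2\sigma}{4}\right)},\qquad x\in\mathbb{Z}.$$ Then $w_\sigma$ is an optimal Hardy weight of the fractional Laplacian $\Delta^\sigma$ on $\mathbb{Z}$; that is, $w_\sigma$ is a Hardy weight of $\Delta^\sigma$, it is critical, and it is null-critical.
   Context: The Laplacian $\Delta$ on $\ell^2(\mathbb{Z})$ is the bounded operator $\Delta f(x)=(f(x)-f(x+1))+(f(x)-f(x-1))$. For $\sigma\in(0,1)$ the fractional Laplacian $\Delta^\sigma$ is the bounded operator on $\ell^2(\mathbb{Z})$ defined by the spectral calculus of $\Delta$. It can be written as $$\Delta^\sigma f(x)=\sum_{y\in\mathbb{Z}}\kappa_\sigma(x-y)(f(x)-f(y)),$$ where $\kappa_\sigma(0)=0$ and, for $x\neq 0$, $$\kappa_\sigma(x)=\frac{1}{|\Gamma(-\sigma)|}\int_0^\infty e^{-t\Delta}1_0(x)\,\frac{\mathrm{d}t}{t^{1+\sigma}}=\frac{4^\sigma\Gamma(\frac12+\sigma)}{\sqrt{\pi}\,|\Gamma(-\sigma)|}\cdot\frac{\Gamma(|x|-\sigma)}{\Gamma(|x|+1+\sigma)}.$$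 Here $1_0$ is the characteristic function of $\{0\}$. By this formula $\Delta^\sigma$ is extended to all functions in the Banach space $B_\sigma=\ell^1(\mathbb{Z},(1+|\cdot|)^{-1-2\sigma})$. $C_c(\mathbb{Z})$ denotes the finitely supported real functions on $\mathbb{Z}$, and $\langle\cdot,\cdot\rangle$ is the inner product of $\ell^2(\mathbb{Z})$. Definitions. A non-trivial function $w:\mathbb{Z}\to[0,\infty)$ is a Hardy weight (of $\Delta^\sigma$) if $\langle\Delta^\sigma\varphi,\varphi\rangle\ge\langle w\varphi,\varphi\rangle$ for all $\varphi\in C_c(\mathbb{Z})$. A Hardy weight $w$ is critical if every Hardy weight $w'\ge w$ satisfies $w'=w$. If $w$ is critical, there exists a positive function $\psi$ (not necessarily in $\ell^2(\mathbb{Z})$), unique up to multiplicative constants, with $(\Delta^\sigma-w)\psi=0$; it is called the Agmon ground state. A critical Hardy weight $w$ is positive-critical if $\psi\in\ell^2(\mathbb{Z},w)$, i.e. $\sum_{x\in\mathbb{Z}}\psi(x)^2w(x)<\infty$, and null-critical otherwise. A Hardy weight is optimal if it is critical and null-critical. *)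

theory Defs
  imports "HOL-Analysis.Analysis" "HOL-Computational_Algebra.Polynomial"
begin

definition ell2 :: "(int \<Rightarrow> real) set"
  where "ell2 = {f. (\<lambda>x. (f x)\<^sup>2) summable_on UNIV}"

definition ell2_norm :: "(int \<Rightarrow> real) \<Rightarrow> real"
  where "ell2_norm f = sqrt (\<Sum>\<^sub>\<infinity>x. (f x)\<^sup>2)"

definition ell2_inner :: "(int \<Rightarrow> real) \<Rightarrow> (int \<Rightarrow> real) \<Rightarrow> real"
  where "ell2_inner f g = (\<Sum>\<^sub>\<infinity>x. f x * g x)"

definition fin_supp :: "(int \<Rightarrow> real) set"
  where "fin_supp = {f. finite {x. f x \<noteq> 0}}"

definition lap :: "(int \<Rightarrow> real) \<Rightarrow> int \<Rightarrow> real"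
  where "lap f x = (f x - f (x + 1)) + (f x - f (x - 1))"

definition lap_poly :: "real poly \<Rightarrow> (int \<Rightarrow> real) \<Rightarrow> int \<Rightarrow> real"
  where "lap_poly p f x = (\<Sum>i\<le>degree p. coeff p i * (lap ^^ i) f x)"

text \<open>
  Continuous functional calculus of the bounded self-adjoint operator \<open>lap\<close> on \<open>ell2\<close>,
  for functions \<open>g\<close> continuous on its spectrum, which is the interval \<open>{0..4}\<close>:
  \<open>g(\<Delta>) f\<close> is the limit in \<open>ell2\<close> of \<open>p\<^sub>n(\<Delta>) f\<close> for any polynomials \<open>p\<^sub>n\<close> that
  tend to \<open>g\<close> uniformly on the spectrum. Such polynomials exist by the Weierstrass theorem, so
  the limit is unique. The definition is meaningful for \<open>f \<in> ell2\<close> only.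
\<close>

definition lap_calculus :: "(real \<Rightarrow> real) \<Rightarrow> (int \<Rightarrow> real) \<Rightarrow> int \<Rightarrow> real"
  where "lap_calculus g f =
    (THE h. h \<in> ell2 \<and>
      (\<forall>p. uniform_limit {0..4} (\<lambda>n. poly (p n)) g sequentially \<longrightarrow>
           (\<lambda>n. ell2_norm (\<lambda>x. lap_poly (p n) f x - h x)) \<longlonglongrightarrow> 0))"

definition frac_lap :: "real \<Rightarrow> (int \<Rightarrow> real) \<Rightarrow> int \<Rightarrow> real"
  where "frac_lap \<sigma> = lap_calculus (\<lambda>s. s powr \<sigma>)"

definition heat_semigroup :: "real \<Rightarrow> (int \<Rightarrow> real) \<Rightarrow> int \<Rightarrow> real"
  where "heat_semigroup t = lap_calculus (\<lambda>s. exp (- t * s))"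

definition frac_kernel :: "real \<Rightarrow> int \<Rightarrow> real"
  where "frac_kernel \<sigma> x =
    (if x = 0 then 0
     else 1 / \<bar>Gamma (- \<sigma>)\<bar> *
       (LBINT t:{0<..}. heat_semigroup t (indicator {0}) x / t powr (1 + \<sigma>)))"

definition frac_dom :: "real \<Rightarrow> (int \<Rightarrow> real) set"
  where "frac_dom \<sigma> =
    {f. (\<lambda>x. \<bar>f x\<bar> * (1 + \<bar>real_of_int x\<bar>) powr (- 1 - 2 * \<sigma>)) summable_on UNIV}"

text \<open>The extension of \<open>frac_lap \<sigma>\<close> from \<open>ell2\<close> to \<open>frac_dom \<sigma>\<close>.\<close>

definition frac_lap_ext :: "real \<Rightarrow> (int \<Rightarrow> real) \<Rightarrow> int \<Rightarrow> real"
  where "frac_lap_ext \<sigma> f x = (\<Sum>\<^sub>\<infinity>y. frac_kernel \<sigma> (x - y) * (f x - f y))"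

definition hardy_weight :: "real \<Rightarrow> (int \<Rightarrow> real) \<Rightarrow> bool"
  where "hardy_weight \<sigma> w \<longleftrightarrow>
    (\<forall>x. 0 \<le> w x) \<and> (\<exists>x. w x \<noteq> 0) \<and>
    (\<forall>\<phi>\<in>fin_supp. ell2_inner (frac_lap \<sigma> \<phi>) \<phi> \<ge> ell2_inner (\<lambda>x. w x * \<phi> x) \<phi>)"

definition critical :: "real \<Rightarrow> (int \<Rightarrow> real) \<Rightarrow> bool"
  where "critical \<sigma> w \<longleftrightarrow>
    hardy_weight \<sigma> w \<and> (\<forall>w'. hardy_weight \<sigma> w' \<and> (\<forall>x. w x \<le> w' x) \<longrightarrow> w' = w)"

definition agmon_ground_state :: "real \<Rightarrow> (int \<Rightarrow> real) \<Rightarrow> (int \<Rightarrow> real) \<Rightarrow> bool"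
  where "agmon_ground_state \<sigma> w \<psi> \<longleftrightarrow>
    (\<forall>x. 0 < \<psi> x) \<and> \<psi> \<in> frac_dom \<sigma> \<and> (\<forall>x. frac_lap_ext \<sigma> \<psi> x - w x * \<psi> x = 0)"

text \<open>
  For a critical weight the ground state exists and is unique up to a multiplicative constant, so
  null-criticality is a condition on any ground state. Existence is nevertheless part of the
  definition, so that it cannot hold vacuously.
\<close>

definition null_critical :: "real \<Rightarrow> (int \<Rightarrow> real) \<Rightarrow> bool"
  where "null_critical \<sigma> w \<longleftrightarrow>
    critical \<sigma> w \<and> (\<exists>\<psi>. agmon_ground_state \<sigma> w \<psi>) \<and>
    (\<forall>\<psi>. agmon_ground_state \<sigma> w \<psi> \<longrightarrow> \<not> (\<lambda>x. (\<psi> x)\<^sup>2 * w x) summable_on UNIV)"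

definition optimal_hardy_weight :: "real \<Rightarrow> (int \<Rightarrow> real) \<Rightarrow> bool"
  where "optimal_hardy_weight \<sigma> w \<longleftrightarrow>
    hardy_weight \<sigma> w \<and> critical \<sigma> w \<and> null_critical \<sigma> w"

definition w_opt :: "real \<Rightarrow> int \<Rightarrow> real"
  where "w_opt \<sigma> x =
    4 powr \<sigma> * ((Gamma ((1 + 2 * \<sigma>) / 4))\<^sup>2 / (Gamma ((1 - 2 * \<sigma>) / 4))\<^sup>2) *
    ((Gamma (\<bar>real_of_int x\<bar> + (1 - 2 * \<sigma>) / 4) * Gamma (\<bar>real_of_int x\<bar> + (3 - 2 * \<sigma>) / 4)) /
     (Gamma (\<bar>real_of_int x\<bar> + (3 + 2 * \<sigma>) / 4) * Gamma (\<bar>real_of_int x\<bar> + (1 + 2 * \<sigma>) / 4)))"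

end

theory Submission imports Defs begin

text \<open>
  On the frequency \<open>2 t\<close> the Laplacian is multiplication by \<open>4 (sin t)\<^sup>2\<close>, so the
  convolution kernel of its power \<open>p > -1/2\<close> is the cosine coefficient
  \<open>c\<^sub>p(x) = 2/\<pi> \<integral> (4 (sin t)\<^sup>2)\<^sup>p cos (2 x t) dt\<close> over \<open>[0, \<pi>/2]\<close>
  (\<open>power_coeff\<close>). Integrating one exact derivative gives the first-order recurrence
  \<open>(x + 1 + p) c\<^sub>p(x + 1) = (x - p) c\<^sub>p(x)\<close> (\<open>power_coeff_rec\<close>). It
  determines their signs and their decay: for \<open>-1/2 < p < 0\<close> they are positive and decrease to 0 on
  the naturals, and \<open>c\<^sub>\<sigma>\<close> is negative away from 0, where \<open>c\<^sub>\<sigma> = -\<kappa>\<^sub>\<sigma>\<close>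
  (\<open>frac_kernel_eq\<close>).

  Put \<open>\<alpha> = (1 + 2\<sigma>)/4\<close> and \<open>\<psi> = c\<^bsub>-\<alpha>\<^esub>\<close>. Multiplying symbols
  convolves kernels (\<open>cos_coeff_mult\<close>), hence \<open>\<Delta>\<^sup>\<sigma> \<psi> = c\<^bsub>\<sigma>-\<alpha>\<^esub>\<close>, and the
  Gamma quotients show that \<open>w\<^sub>\<sigma> = c\<^bsub>\<sigma>-\<alpha>\<^esub> / \<psi>\<close>. So \<open>\<psi>\<close> is a positive solution of
  \<open>(\<Delta>\<^sup>\<sigma> - w\<^sub>\<sigma>) \<psi> = 0\<close>. For any positive solution \<open>u\<close> the ground state representation
  bounds \<open>\<langle>(\<Delta>\<^sup>\<sigma> - w\<^sub>\<sigma>) \<phi>, \<phi>\<rangle>\<close> below by each of the nonnegative terms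
  \<open>\<kappa>\<^sub>\<sigma>(x - y) u(x) u(y) (\<phi>(x)/u(x) - \<phi>(y)/u(y))\<^sup>2\<close>
  (\<open>ground_state_inequality\<close>). This contains the Hardy inequality.

  Criticality needs finitely supported functions that tend to \<open>\<psi>\<close> pointwise while their form
  tends to 0. The truncations \<open>\<psi>\<^sub>N = max (\<psi> - \<psi>(N)) 0\<close> only have bounded form: since
  \<open>\<psi>\<close> is decreasing, \<open>\<Delta>\<^sup>\<sigma> \<psi>\<^sub>N \<le> w\<^sub>\<sigma> \<psi>\<close> on the window \<open>[-N, N]\<close>, so the form of
  \<open>\<psi>\<^sub>N\<close> is at most \<open>\<psi>(N)\<close> times the sum of \<open>w\<^sub>\<sigma> \<psi>\<close> over the window, which is
  bounded. The same estimate bounds the mixed form of \<open>\<psi>\<^sub>N\<close> and a fixed nonnegative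
  function from above by a quantity that tends to 0 as \<open>N\<close> grows. Hence averages of \<open>K\<close> truncations at sufficiently sparse levels have form
  \<open>O(1/K)\<close> (\<open>null_sequence\<close>). Tested on this sequence, no Hardy weight above
  \<open>w\<^sub>\<sigma>\<close> can differ from it (\<open>weight_maximal\<close>), and the representation with respect to
  another ground state \<open>u\<close> forces \<open>\<psi>/u\<close> to be constant (\<open>solution_unique\<close>).

  Finally \<open>w\<^sub>\<sigma>(n) \<psi>(n)\<^sup>2\<close> is comparable to \<open>1/n\<close>: the upper bound gives the bounded
  forms, the lower bound and the divergence of the harmonic series give null-criticality.
\<close>

section \<open>Sequences with a power decay and sums over the integers\<close>

text \<open>
  The factor satisfies \<open>1 - p/m \<le> exp (-p/m) \<le> (m/(m + 1))\<^sup>p\<close> with \<open>m = n + c\<close>, and the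
  product of these powers telescopes.
\<close>

lemma powr_decay:
  fixes f :: "nat \<Rightarrow> real"
  assumes f: "\<And>n. 0 \<le> f n" and c: "c > 0" and p: "p \<ge> 0"
    and step: "\<And>n. f (Suc n) \<le> (1 - p / (n + c)) * f n"
  shows "f n \<le> f 0 * (c / (n + c)) powr p"
proof (induction n)
  case 0
  then show ?case using c by simp
next
  case (Suc n)
  define m where "m = real n + c"
  have m: "m > 0" using c by (simp add: m_def)
  have "1 - p / m \<le> exp (- (p / m))" using exp_ge_add_one_self[of "- (p/m)"] by simp
  also have "\<dots> \<le> exp (p * ln (m / (m + 1)))"
  proof -
    have "ln (1 + 1 / m) \<le> 1 / m" using m ln_add_one_self_le_self[of "1/m"] by simp
    then have "ln ((m + 1) / m) \<le> 1 / m" using m by (simp add: add_divide_distrib)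
    then have "- (1 / m) \<le> ln (m / (m + 1))" using m by (simp add: ln_div)
    then show ?thesis using p mult_left_mono[of "- (1/m)" "ln (m / (m + 1))" p] by simp
  qed
  also have "\<dots> = (m / (m + 1)) powr p" using m by (simp add: powr_def)
  finally have le: "1 - p / m \<le> (m / (m + 1)) powr p" .
  have "f (Suc n) \<le> (1 - p / m) * f n" using step[of n] by (simp add: m_def)
  also have "\<dots> \<le> (m / (m + 1)) powr p * f n" using le f by (intro mult_right_mono)
  also have "\<dots> \<le> (m / (m + 1)) powr p * (f 0 * (c / m) powr p)"
    using Suc by (intro mult_left_mono) (auto simp: m_def)
  also have "\<dots> = f 0 * (c / (m + 1)) powr p"
    using m c by (simp add: powr_divide)
  finally show ?case by (simp add: m_def add_ac)
qed

lemma powr_decay_tendsto_0: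
  fixes f :: "nat \<Rightarrow> real"
  assumes f: "\<And>n. 0 \<le> f n" and c: "c > 0" and p: "p > 0"
    and step: "\<And>n. f (Suc n) \<le> (1 - p / (n + c)) * f n"
  shows "f \<longlonglongrightarrow> 0"
proof (rule tendsto_sandwich[of "\<lambda>_. 0"])
  show "eventually (\<lambda>n. f n \<le> f 0 * (c / (n + c)) powr p) sequentially"
    using powr_decay[OF f c _ step] p by auto
  have "(\<lambda>n. c / (real n + c)) \<longlonglongrightarrow> 0"
  proof (rule tendsto_divide_0[OF tendsto_const])
    have "filterlim (\<lambda>n. c + real n) at_top sequentially"
      by (rule filterlim_tendsto_add_at_top[OF tendsto_const filterlim_real_sequentially])
    then show "filterlim (\<lambda>n. real n + c) at_infinity sequentially"
      by (intro filterlim_at_top_imp_at_infinity) (simp add: add.commute)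
  qed
  then have "(\<lambda>n. (c / (real n + c)) powr p) \<longlonglongrightarrow> 0 powr p"
    using c p by (intro tendsto_powr2) auto
  from tendsto_mult_left[OF this, of "f 0"] show "(\<lambda>n. f 0 * (c / (n + c)) powr p) \<longlonglongrightarrow> 0"
    using p by simp
qed (use f in auto)

lemma summable_on_int_even:
  fixes f :: "int \<Rightarrow> real"
  assumes "\<And>x. 0 \<le> f x" "\<And>x. f (- x) = f x" "summable (\<lambda>n. f (int n))"
  shows "f summable_on UNIV"
proof -
  have n: "(\<lambda>n. f (int n)) summable_on UNIV"
    using assms by (simp add: summable_on_UNIV_nonneg_real_iff)
  then have 1: "f summable_on range int"
    by (subst summable_on_reindex) (auto simp: o_def)
  have 2: "f summable_on range (\<lambda>n. - int n)"
    by (subst summable_on_reindex) (use n assms(2) in \<open>auto simp: o_def inj_on_def\<close>)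
  have "f summable_on (range (\<lambda>n. - int n) - range int)"
    using 2 by (rule summable_on_subset) auto
  with 1 have "f summable_on (range int \<union> (range (\<lambda>n. - int n) - range int))"
    by (intro summable_on_Un_disjoint) auto
  moreover have "range int \<union> (range (\<lambda>n. - int n) - range int) = UNIV"
  proof -
    have "x \<in> range int \<or> x \<in> range (\<lambda>n. - int n)" for x :: int
      by (cases x rule: int_cases2) auto
    then show ?thesis by blast
  qed
  ultimately show ?thesis by simp
qed

section \<open>Cosine coefficients of powers of the symbol\<close>

text \<open>
  The functions \<open>cos (2 x t)\<close> on \<open>[0, \<pi>/2]\<close> replace the characters of the circle: all
  symbols are even and \<open>\<pi>\<close>-periodic in \<open>t\<close>. With the frequency written as \<open>2 t\<close> the
  symbol \<open>2 - 2 cos (2 t)\<close> is a square, and the only zero in the interval is the end point 0.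
\<close>

definition lap_symbol :: "real \<Rightarrow> real" where "lap_symbol t = 4 * (sin t)\<^sup>2"

definition cos_coeff :: "(real \<Rightarrow> real) \<Rightarrow> int \<Rightarrow> real"
  where "cos_coeff h x = 2 / pi * integral {0..pi/2} (\<lambda>t. h t * cos (2 * of_int x * t))"

text \<open>
  The convolution kernel of the \<open>p\<close>-th power of the Laplacian. It is used for
  \<open>-1/2 < p < 1/2\<close>; for negative \<open>p\<close> the integrand has an integrable singularity at 0.
\<close>

definition power_coeff :: "real \<Rightarrow> int \<Rightarrow> real"
  where "power_coeff p = cos_coeff (\<lambda>t. lap_symbol t powr p)"

lemma abs_integrable_times_cos:
  fixes h :: "real \<Rightarrow> real"
  assumes "h absolutely_integrable_on {a..b}"
  shows "(\<lambda>t. h t * cos (c * t)) absolutely_integrable_on {a..b}"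
proof -
  have "(\<lambda>t. cos (c * t) * h t) absolutely_integrable_on {a..b}"
  proof (rule absolutely_integrable_bounded_measurable_product_real[OF _ _ _ assms])
    show "(\<lambda>t. cos (c * t)) \<in> borel_measurable (lebesgue_on {a..b})"
      by (intro continuous_imp_measurable_on_sets_lebesgue continuous_intros) auto
    show "bounded ((\<lambda>t. cos (c * t)) ` {a..b})"
      by (rule boundedI[of _ 1]) auto
  qed auto
  then show ?thesis by (simp add: mult.commute)
qed

lemma integrable_times_cos:
  fixes h :: "real \<Rightarrow> real"
  assumes "h absolutely_integrable_on {a..b}"
  shows "(\<lambda>t. h t * cos (c * t)) integrable_on {a..b}"
  using abs_integrable_times_cos[OF assms] by (rule set_lebesgue_integral_eq_integral)

lemma cos_coeff_minus: "cos_coeff h (- x) = cos_coeff h x"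
  by (simp add: cos_coeff_def)

lemma cos_coeff_abs_le:
  assumes "h absolutely_integrable_on {0..pi/2}"
  shows "\<bar>cos_coeff h x\<bar> \<le> 2 / pi * integral {0..pi/2} (\<lambda>t. \<bar>h t\<bar>)"
proof -
  have "(\<lambda>t. \<bar>h t\<bar>) integrable_on {0..pi/2}"
    using assms by (simp add: absolutely_integrable_on_def)
  then have "norm (integral {0..pi/2} (\<lambda>t. h t * cos (2 * of_int x * t)))
    \<le> integral {0..pi/2} (\<lambda>t. \<bar>h t\<bar>)"
    by (intro integral_norm_bound_integral integrable_times_cos assms)
       (auto simp: abs_mult intro!: mult_left_le)
  then show ?thesis by (simp add: cos_coeff_def abs_mult divide_right_mono)
qed

lemma lap_symbol_nonneg: "0 \<le> lap_symbol t" by (simp add: lap_symbol_def)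

lemma lap_symbol_range: "lap_symbol t \<in> {0..4}"
  using abs_square_le_1[of "sin t"] by (simp add: lap_symbol_def)

lemma sin_sq_image: "(\<lambda>t. (sin t)\<^sup>2) ` {0<..<pi/2} = {0<..<1::real}"
proof (intro set_eqI iffI)
  fix u :: real assume u: "u \<in> {0<..<1}"
  have s: "0 < sqrt u" "sqrt u < 1" using u by auto
  then have "arcsin (sqrt u) \<in> {0<..<pi/2}"
    using arcsin_less_arcsin[of 0 "sqrt u"] arcsin_less_arcsin[of "sqrt u" 1] order_trans[of "-1" 0 "sqrt u"] by auto
  moreover have "sin (arcsin (sqrt u)) = sqrt u" using s by (intro sin_arcsin) linarith+
  then have "u = (sin (arcsin (sqrt u)))\<^sup>2" using u by simp
  ultimately show "u \<in> (\<lambda>t. (sin t)\<^sup>2) ` {0<..<pi/2}" by blast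
next
  fix u :: real assume "u \<in> (\<lambda>t. (sin t)\<^sup>2) ` {0<..<pi/2}"
  then obtain t where t: "0 < t" "t < pi/2" "u = (sin t)\<^sup>2" by auto
  have "0 < sin t" using t by (intro sin_gt_zero) auto
  moreover have "sin t < 1" using t sin_monotone_2pi[of t "pi/2"] by simp
  ultimately show "u \<in> {0<..<1}" using t by (simp add: abs_square_less_1)
qed

text \<open>
  The substitution \<open>u = (sin t)\<^sup>2\<close> turns the integral into a Beta integral. Integrability of
  the singular powers comes out of the same substitution.
\<close>

lemma integral_lap_symbol_powr:
  assumes "p > - 1/2"
  shows "(\<lambda>t. lap_symbol t powr p) absolutely_integrable_on {0..pi/2} \<and>
    integral {0..pi/2} (\<lambda>t. lap_symbol t powr p) = 4 powr p / 2 * Beta (p + 1/2) (1/2)"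
proof -
  define S where "S = {0<..<pi/2}"
  define f :: "real \<Rightarrow> real" where "f = (\<lambda>u. u powr (p + 1/2 - 1) * (1 - u) powr (1/2 - 1))"
  define B where "B = Beta (p + 1/2) (1/2)"
  have hi: "(f has_integral B) {0<..<1}"
    using has_integral_Beta_real[of "p+1/2" "1/2"] assms
    unfolding f_def B_def by (simp add: has_integral_Icc_iff_Ioo)
  have fi: "f absolutely_integrable_on {0<..<1}"
    using hi by (intro nonnegative_absolutely_integrable_1) (auto simp: f_def has_integral_integrable)
  have inj: "inj_on (\<lambda>t. (sin t)\<^sup>2) S"
  proof (rule inj_onI)
    fix s t assume st: "s \<in> S" "t \<in> S" "(sin s)\<^sup>2 = (sin t)\<^sup>2"
    then have "0 \<le> sin s" "0 \<le> sin t" by (auto simp: S_def intro!: sin_ge_zero)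
    with st(3) have "sin s = sin t" by (rule power2_eq_imp_eq)
    then show "s = t" using st(1,2) by (intro sin_inj_pi[of s t]) (simp_all add: S_def)
  qed
  have der: "((\<lambda>t. (sin t)\<^sup>2) has_real_derivative 2 * sin t * cos t) (at t within S)" for t
    by (auto intro!: derivative_eq_intros)
  have "f absolutely_integrable_on (\<lambda>t. (sin t)\<^sup>2) ` S \<and> integral ((\<lambda>t. (sin t)\<^sup>2) ` S) f = B"
    using fi hi unfolding S_def sin_sq_image by auto
  then have sub: "(\<lambda>t. \<bar>2 * sin t * cos t\<bar> * f ((sin t)\<^sup>2)) absolutely_integrable_on S"
    "integral S (\<lambda>t. \<bar>2 * sin t * cos t\<bar> * f ((sin t)\<^sup>2)) = B"
    using has_absolute_integral_change_of_variables_1'[OF _ der inj, of f B]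
    by (simp_all add: S_def)
  have eq: "\<bar>2 * sin t * cos t\<bar> * f ((sin t)\<^sup>2) = 2 / 4 powr p * lap_symbol t powr p" if "t \<in> S" for t
  proof -
    have s: "0 < sin t" "0 < cos t" using that by (auto simp: S_def intro!: sin_gt_zero cos_gt_zero)
    have c: "1 - (sin t)\<^sup>2 = (cos t)\<^sup>2" by (simp add: cos_squared_eq)
    have r: "(y\<^sup>2) powr (-1/2) = 1 / y" if "y > 0" for y :: real
      using that powr_powr[of y 2 "-1/2"] by (simp add: powr_minus_divide)
    have 2: "(sin t)\<^sup>2 powr (p + 1/2 - 1) = (sin t)\<^sup>2 powr p * ((sin t)\<^sup>2 powr (-1/2))"
      by (simp flip: powr_add)
    have "f ((sin t)\<^sup>2) = (sin t)\<^sup>2 powr p * (1 / sin t) * (1 / cos t)"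
      using r[OF s(1)] r[OF s(2)] unfolding f_def c 2 by simp
    then show ?thesis using s unfolding lap_symbol_def
      by (simp add: powr_mult abs_mult)
  qed
  have hS: "((\<lambda>t. 2 / 4 powr p * lap_symbol t powr p) has_integral B) S"
  proof (rule has_integral_eq[OF eq])
    show "((\<lambda>t. \<bar>2 * sin t * cos t\<bar> * f ((sin t)\<^sup>2)) has_integral B) S"
      using integrable_integral[OF set_lebesgue_integral_eq_integral(1)[OF sub(1)]] unfolding sub(2) .
  qed auto
  have "((\<lambda>t. 4 powr p / 2 * (2 / 4 powr p * lap_symbol t powr p)) has_integral 4 powr p / 2 * B) {0..pi/2}"
    using has_integral_mult_right[OF hS] unfolding S_def has_integral_Icc_iff_Ioo .
  then have h: "((\<lambda>t. lap_symbol t powr p) has_integral 4 powr p / 2 * B) {0..pi/2}"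
    by simp
  show ?thesis using integral_unique[OF h] has_integral_integrable[OF h] unfolding B_def
    by (auto intro!: nonnegative_absolutely_integrable_1)
qed

text \<open>
  The integrand is the derivative of \<open>(sin t)\<^bsup>2p+1\<^esup> cos ((2x+1) t)\<close>, which is continuous up to
  \<open>t = 0\<close> because \<open>2p + 1 > 0\<close> and vanishes there.
\<close>

lemma has_integral_lap_symbol_powr_cos:
  assumes "p > - 1/2"
  shows "((\<lambda>t. sin t powr (2 * p) * ((p + x + 1) * cos ((2 * x + 2) * t) + (p - x) * cos (2 * x * t)))
    has_integral cos ((2 * x + 1) * (pi/2))) {0..pi/2}"
proof -
  define F where "F = (\<lambda>t. sin t powr (2 * p + 1) * cos ((2 * x + 1) * t))"
  have "((\<lambda>t. sin t powr (2 * p) * ((p + x + 1) * cos ((2 * x + 2) * t) + (p - x) * cos (2 * x * t)))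
    has_integral F (pi/2) - F 0) {0..pi/2}"
  proof (rule fundamental_theorem_of_calculus_interior)
    show "continuous_on {0..pi/2} F"
      unfolding F_def using assms by (intro continuous_intros continuous_on_powr') (auto intro!: sin_ge_zero)
    fix t assume t: "t \<in> {0<..<pi/2}"
    then have s: "0 < sin t" by (intro sin_gt_zero) auto
    have e: "cos ((2 * x + 2) * t) = cos ((2*x+1)*t) * cos t - sin ((2*x+1)*t) * sin t"
      "cos (2 * x * t) = cos ((2*x+1)*t) * cos t + sin ((2*x+1)*t) * sin t"
      using cos_add[of "(2*x+1)*t" t] cos_diff[of "(2*x+1)*t" t] by (simp_all add: algebra_simps)
    have "(F has_real_derivative
        ((2*p+1) * sin t powr (2 * p) * cos t) * cos ((2 * x + 1) * t)
         - sin t powr (2 * p + 1) * (sin ((2 * x + 1) * t) * (2 * x + 1))) (at t)"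
      unfolding F_def using s by (auto intro!: derivative_eq_intros)
    moreover have "((2*p+1) * sin t powr (2 * p) * cos t) * cos ((2 * x + 1) * t)
         - sin t powr (2 * p + 1) * (sin ((2 * x + 1) * t) * (2 * x + 1))
       = sin t powr (2 * p) * ((p + x + 1) * cos ((2 * x + 2) * t) + (p - x) * cos (2 * x * t))"
      unfolding e using s by (simp add: powr_add algebra_simps)
    ultimately show "(F has_vector_derivative
       sin t powr (2 * p) * ((p + x + 1) * cos ((2 * x + 2) * t) + (p - x) * cos (2 * x * t))) (at t)"
      by (simp add: has_real_derivative_iff_has_vector_derivative)
  qed simp
  then show ?thesis by (simp add: F_def)
qed

lemma lap_symbol_powr_integrable: "p > - 1/2 \<Longrightarrow> (\<lambda>t. lap_symbol t powr p) absolutely_integrable_on {0..pi/2}"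
  using integral_lap_symbol_powr by blast

lemma power_coeff_0:
  assumes "p > - 1/2"
  shows "power_coeff p 0 = 4 powr p * Gamma (p + 1/2) / (sqrt pi * Gamma (p + 1))"
proof -
  have "power_coeff p 0 = 2 / pi * (4 powr p / 2 * (Gamma (p + 1/2) * sqrt pi / Gamma (p + 1)))"
    using integral_lap_symbol_powr[OF assms] by (simp add: power_coeff_def cos_coeff_def Beta_def Gamma_one_half_real add.assoc)
  also have "\<dots> = 4 powr p * Gamma (p + 1/2) * (sqrt pi / pi) / Gamma (p + 1)"
    by simp
  also have "sqrt pi / pi = 1 / sqrt pi"
    using real_sqrt_mult_self[of pi] by (simp add: field_simps)
  finally show ?thesis by simp
qed

lemma power_coeff_minus: "power_coeff p (- x) = power_coeff p x"
  by (simp add: power_coeff_def cos_coeff_minus)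

text \<open>
  For integer \<open>x\<close> the boundary term at \<open>\<pi>/2\<close> vanishes as well, since
  \<open>cos ((2x+1) \<pi>/2) = 0\<close>.
\<close>

lemma power_coeff_rec:
  assumes "p > - 1/2"
  shows "(of_int x + 1 + p) * power_coeff p (x + 1) = (of_int x - p) * power_coeff p x"
proof -
  define X where "X = real_of_int x"
  have i: "(\<lambda>t. lap_symbol t powr p * cos (c * t)) integrable_on {0..pi/2}" for c
    by (intro integrable_times_cos lap_symbol_powr_integrable assms)
  have "cos ((2 * X + 1) * (pi/2)) = 0"
    unfolding cos_zero_iff_int by (intro exI[of _ "2 * x + 1"]) (simp add: X_def)
  then have "((\<lambda>t. sin t powr (2 * p) * ((p + X + 1) * cos ((2 * X + 2) * t) + (p - X) * cos (2 * X * t)))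
    has_integral 0) {0..pi/2}"
    using has_integral_lap_symbol_powr_cos[OF assms, of X] by simp
  then have "((\<lambda>t. 4 powr p * (sin t powr (2 * p) * ((p + X + 1) * cos ((2 * X + 2) * t) + (p - X) * cos (2 * X * t))))
    has_integral 4 powr p * 0) {0..pi/2}"
    by (rule has_integral_mult_right)
  moreover have "4 powr p * (sin t powr (2 * p) * ((p + X + 1) * cos ((2 * X + 2) * t) + (p - X) * cos (2 * X * t)))
    = (p + X + 1) * (lap_symbol t powr p * cos ((2 * X + 2) * t)) + (p - X) * (lap_symbol t powr p * cos (2 * X * t))"
    if "t \<in> {0..pi/2}" for t
  proof -
    have "0 \<le> sin t" using that by (intro sin_ge_zero) auto
    then have "lap_symbol t powr p = 4 powr p * sin t powr (2 * p)"
      by (cases "sin t = 0") (auto simp: lap_symbol_def powr_mult powr_powr simp flip: powr_numeral)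
    then show ?thesis by (simp add: algebra_simps)
  qed
  ultimately have "((\<lambda>t. (p + X + 1) * (lap_symbol t powr p * cos ((2 * X + 2) * t)) + (p - X) * (lap_symbol t powr p * cos (2 * X * t)))
    has_integral 4 powr p * 0) {0..pi/2}"
    by (rule has_integral_eq[rotated])
  then have "((\<lambda>t. (p + X + 1) * (lap_symbol t powr p * cos ((2 * X + 2) * t)) + (p - X) * (lap_symbol t powr p * cos (2 * X * t)))
    has_integral 0) {0..pi/2}" by simp
  moreover have "((\<lambda>t. (p + X + 1) * (lap_symbol t powr p * cos ((2 * X + 2) * t)) + (p - X) * (lap_symbol t powr p * cos (2 * X * t)))
    has_integral (p + X + 1) * (integral {0..pi/2} (\<lambda>t. lap_symbol t powr p * cos ((2 * X + 2) * t)))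
      + (p - X) * (integral {0..pi/2} (\<lambda>t. lap_symbol t powr p * cos (2 * X * t)))) {0..pi/2}"
    by (intro has_integral_add has_integral_mult_right integrable_integral i)
  ultimately have "(p + X + 1) * (integral {0..pi/2} (\<lambda>t. lap_symbol t powr p * cos ((2 * X + 2) * t)))
      + (p - X) * (integral {0..pi/2} (\<lambda>t. lap_symbol t powr p * cos (2 * X * t))) = 0"
    by (rule has_integral_unique[symmetric])
  then have "(X + 1 + p) * (integral {0..pi/2} (\<lambda>t. lap_symbol t powr p * cos ((2 * X + 2) * t)))
      = (X - p) * (integral {0..pi/2} (\<lambda>t. lap_symbol t powr p * cos (2 * X * t)))"
    by (simp add: algebra_simps)
  then show ?thesis
    by (simp add: power_coeff_def cos_coeff_def X_def field_simps)
qed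

lemma power_coeff_abs: "power_coeff p x = power_coeff p (int (nat \<bar>x\<bar>))"
  by (cases "x \<ge> 0") (auto simp: power_coeff_minus[of p x, symmetric])

lemma power_coeff_Suc:
  assumes "p > - 1/2"
  shows "power_coeff p (int (Suc n)) = (real n - p) / (real n + 1 + p) * power_coeff p (int n)"
  using power_coeff_rec[OF assms, of "int n"] assms by (simp add: field_simps)

lemma power_coeff_0_pos: "p > - 1/2 \<Longrightarrow> 0 < power_coeff p 0"
  by (subst power_coeff_0) (auto intro!: divide_pos_pos mult_pos_pos Gamma_real_pos)

lemma power_coeff_pos:
  assumes p: "- 1/2 < p" "p < 0"
  shows "0 < power_coeff p x"
proof -
  have "0 < power_coeff p (int n)" for n
  proof (induction n)
    case 0
    then show ?case using power_coeff_0_pos[of p] p by simp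
  next
    case (Suc n)
    then show ?case unfolding power_coeff_Suc[OF p(1)] using p by (intro mult_pos_pos divide_pos_pos) auto
  qed
  then show ?thesis by (subst power_coeff_abs)
qed

lemma power_coeff_decr:
  assumes p: "- 1/2 < p" "p < 0" and le: "\<bar>x\<bar> \<le> \<bar>y\<bar>"
  shows "power_coeff p y \<le> power_coeff p x"
proof -
  have "power_coeff p (int (Suc n)) \<le> power_coeff p (int n)" for n
    unfolding power_coeff_Suc[OF p(1)] using p power_coeff_pos[OF p, of "int n"]
    by (intro mult_left_le_one_le) (auto intro!: divide_nonneg_pos)
  then have "power_coeff p (int (nat \<bar>y\<bar>)) \<le> power_coeff p (int (nat \<bar>x\<bar>))"
    by (rule lift_Suc_antimono_le) (use le in simp)
  then show ?thesis by (simp only: power_coeff_abs[symmetric])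
qed

lemma power_coeff_vanish:
  assumes p: "- 1/2 < p" "p < 0"
  shows "(\<lambda>n. power_coeff p (int n)) \<longlonglongrightarrow> 0"
proof (rule powr_decay_tendsto_0[of _ 1 "1 + 2 * p"])
  show "0 \<le> power_coeff p (int n)" for n using power_coeff_pos[OF p, of "int n"] by simp
  show "power_coeff p (int (Suc n)) \<le> (1 - (1 + 2 * p) / (real n + 1)) * power_coeff p (int n)" for n
  proof -
    have "(real n - p) / (real n + 1 + p) = 1 - (1 + 2 * p) / (real n + 1 + p)"
      using p by (simp add: field_simps)
    moreover have "(1 + 2 * p) / (real n + 1) \<le> (1 + 2 * p) / (real n + 1 + p)"
      using p by (intro divide_left_mono) auto
    ultimately show ?thesis
      unfolding power_coeff_Suc[OF p(1)] using power_coeff_pos[OF p, of "int n"] by (intro mult_right_mono) auto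
  qed
qed (use p in auto)

lemma power_coeff_Gamma:
  assumes p: "- 1/2 < p" "p < 0"
  shows "power_coeff p x = 4 powr p * Gamma (p + 1/2) / (sqrt pi * Gamma (- p))
    * (Gamma (\<bar>real_of_int x\<bar> - p) / Gamma (\<bar>real_of_int x\<bar> + 1 + p))"
proof -
  define K where "K = 4 powr p * Gamma (p + 1/2) / (sqrt pi * Gamma (- p))"
  have "power_coeff p (int n) = K * (Gamma (real n - p) / Gamma (real n + 1 + p))" for n
  proof (induction n)
    case 0
    have "Gamma (- p) > 0" using p by (intro Gamma_real_pos) auto
    then have "Gamma (- p) \<noteq> 0" by linarith
    then show ?case using p by (simp add: power_coeff_0 K_def add.commute)
  next
    case (Suc n)
    have "real n - p \<notin> \<int>\<^sub>\<le>\<^sub>0" "real n + 1 + p \<notin> \<int>\<^sub>\<le>\<^sub>0"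
      using p by (auto dest: nonpos_Ints_nonpos)
    then have G: "Gamma (real (Suc n) - p) = (real n - p) * Gamma (real n - p)"
      "Gamma (real (Suc n) + 1 + p) = (real n + 1 + p) * Gamma (real n + 1 + p)"
      using Gamma_plus1[of "real n - p"] Gamma_plus1[of "real n + 1 + p"] by (simp_all add: algebra_simps)
    show ?case unfolding power_coeff_Suc[OF p(1)] Suc G by simp
  qed
  from this[of "nat \<bar>x\<bar>"] show ?thesis
    by (subst power_coeff_abs) (simp add: K_def)
qed

section \<open>Bessel inequality and the Laplacian on cosine coefficients\<close>

abbreviation window :: "nat \<Rightarrow> int set" where "window N \<equiv> {- int N..int N}"

lemma filterlim_window: "filterlim window (finite_subsets_at_top UNIV) sequentially"
  unfolding filterlim_finite_subsets_at_top
proof (intro allI impI)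
  fix X :: "int set" assume "finite X \<and> X \<subseteq> UNIV"
  then obtain B where B: "\<And>x. x \<in> X \<Longrightarrow> \<bar>x\<bar> \<le> B"
    using bdd_above_finite[of "abs ` X"] by (auto simp: bdd_above_def)
  show "eventually (\<lambda>N. finite (window N) \<and> X \<subseteq> window N \<and> window N \<subseteq> UNIV) sequentially"
    using eventually_ge_at_top[of "nat B"]
  proof eventually_elim
    case (elim N)
    have "\<bar>x\<bar> \<le> int N" if "x \<in> X" for x using B[OF that] elim by simp
    then show ?case by (force simp: abs_le_iff)
  qed
qed

lemma finite_subset_window:
  assumes "finite X"
  obtains N where "X \<subseteq> window N"
proof -
  have "eventually (\<lambda>N. finite (window N) \<and> X \<subseteq> window N \<and> window N \<subseteq> UNIV) sequentially"
    using filterlim_window assms unfolding filterlim_finite_subsets_at_top by blast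
  then show ?thesis using that by (auto simp: eventually_sequentially)
qed

lemma has_integral_cos:
  "((\<lambda>t. cos (2 * of_int x * t)) has_integral (if x = 0 then pi/2 else 0)) {0..pi/2}"
proof (cases "x = 0")
  case True
  then show ?thesis using has_integral_const_real[of "1::real" 0 "pi/2"] by simp
next
  case False
  have "((\<lambda>t. cos (2 * of_int x * t)) has_integral
      sin (2 * of_int x * (pi/2)) / (2 * of_int x) - sin (2 * of_int x * 0) / (2 * of_int x)) {0..pi/2}"
    using False
    by (intro fundamental_theorem_of_calculus)
       (auto simp flip: has_real_derivative_iff_has_vector_derivative intro!: derivative_eq_intros)
  moreover have "sin (2 * of_int x * (pi/2)) = 0"
    using sin_times_pi_eq_0[of "of_int x"] by simp
  ultimately show ?thesis using False by simp
qed

lemma cos_mult_cos: "cos u * cos v = (cos (u + v) + cos (u - v)) / (2::real)"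
  by (simp add: cos_add cos_diff)

lemma has_integral_cos_cos:
  "((\<lambda>t. cos (2 * of_int x * t) * cos (2 * of_int y * t)) has_integral
     pi/4 * (of_bool (y = - x) + of_bool (y = x))) {0..pi/2}"
proof -
  have "((\<lambda>t. (cos (2 * of_int (x + y) * t) + cos (2 * of_int (x - y) * t)) / 2) has_integral
     ((if x + y = 0 then pi/2 else 0) + (if x - y = 0 then pi/2 else 0)) / 2) {0..pi/2}"
    by (intro has_integral_divide has_integral_add has_integral_cos)
  moreover have "(cos (2 * of_int (x + y) * t) + cos (2 * of_int (x - y) * t)) / 2
     = cos (2 * of_int x * t) * cos (2 * of_int y * t)" for t :: real
    by (subst cos_mult_cos) (simp add: algebra_simps)
  moreover have "((if x + y = 0 then pi/2 else 0) + (if x - y = 0 then pi/2 else 0)) / 2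
    = pi/4 * (of_bool (y = - x) + of_bool (y = x))"
    by (auto simp: add_eq_0_iff)
  ultimately show ?thesis by (simp only:)
qed

lemma has_integral_cos_coeff:
  assumes "h absolutely_integrable_on {0..pi/2}"
  shows "((\<lambda>t. h t * cos (2 * of_int x * t)) has_integral pi/2 * cos_coeff h x) {0..pi/2}"
  using integrable_integral[OF integrable_times_cos[OF assms, of "2 * of_int x"]]
  by (simp add: cos_coeff_def)

lemma continuous_abs_integrable:
  fixes h :: "real \<Rightarrow> real"
  shows "continuous_on {0..pi/2} h \<Longrightarrow> h absolutely_integrable_on {0..pi/2}"
  by (rule absolutely_integrable_continuous_real)

text \<open>
  Each of the functions \<open>cos (2 x t)\<close>, \<open>x \<noteq> 0\<close>, is counted twice in the window, so with
  the partial sum \<open>P\<close> both \<open>\<integral> h P\<close> and \<open>\<integral> P\<^sup>2\<close> equal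
  \<open>\<pi>/2\<close> times the sum of squares; the inequality is \<open>\<integral> (h - P)\<^sup>2 \<ge> 0\<close>.
\<close>

lemma cos_coeff_bessel:
  assumes h: "continuous_on {0..pi/2} h"
  shows "(\<Sum>x\<in>window N. (cos_coeff h x)\<^sup>2) \<le> 2 / pi * integral {0..pi/2} (\<lambda>t. (h t)\<^sup>2)"
proof -
  define c where "c = cos_coeff h"
  define P where "P = (\<lambda>t. \<Sum>x\<in>window N. c x * cos (2 * of_int x * t))"
  define C where "C = (\<Sum>x\<in>window N. (c x)\<^sup>2)"
  have hP: "((\<lambda>t. h t * P t) has_integral pi/2 * C) {0..pi/2}"
  proof -
    have "((\<lambda>t. \<Sum>x\<in>window N. c x * (h t * cos (2 * of_int x * t))) has_integral
      (\<Sum>x\<in>window N. c x * (pi/2 * c x))) {0..pi/2}"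
      unfolding c_def
      by (intro has_integral_sum has_integral_mult_right has_integral_cos_coeff continuous_abs_integrable h) auto
    then show ?thesis
      by (simp add: P_def C_def sum_distrib_left power2_eq_square mult_ac)
  qed
  have PP: "((\<lambda>t. P t * P t) has_integral pi/2 * C) {0..pi/2}"
  proof -
    have "((\<lambda>t. \<Sum>x\<in>window N. \<Sum>y\<in>window N. c x * c y * (cos (2 * of_int x * t) * cos (2 * of_int y * t))) has_integral
      (\<Sum>x\<in>window N. \<Sum>y\<in>window N. c x * c y * (pi/4 * (of_bool (y = - x) + of_bool (y = x))))) {0..pi/2}"
      by (intro has_integral_sum has_integral_mult_right has_integral_cos_cos) auto
    moreover have "(\<Sum>y\<in>window N. c x * c y * (pi/4 * (of_bool (y = - x) + of_bool (y = x)))) = pi/2 * (c x)\<^sup>2"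
      if "x \<in> window N" for x
    proof -
      have "(\<Sum>y\<in>window N. c x * c y * (pi/4 * (of_bool (y = - x) + of_bool (y = x))))
        = (\<Sum>y\<in>window N. (if y = - x then c x * c y * pi/4 else 0)) + (\<Sum>y\<in>window N. (if y = x then c x * c y * pi/4 else 0))"
        by (subst sum.distrib[symmetric]) (auto intro!: sum.cong)
      also have "\<dots> = pi/2 * (c x)\<^sup>2"
        using that by (simp add: c_def cos_coeff_minus power2_eq_square)
      finally show ?thesis .
    qed
    then have "(\<Sum>x\<in>window N. \<Sum>y\<in>window N. c x * c y * (pi/4 * (of_bool (y = - x) + of_bool (y = x))))
      = (\<Sum>x\<in>window N. pi/2 * (c x)\<^sup>2)"
      by (rule sum.cong[OF refl])
    ultimately have "((\<lambda>t. \<Sum>x\<in>window N. \<Sum>y\<in>window N. c x * c y * (cos (2 * of_int x * t) * cos (2 * of_int y * t))) has_integral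
      (\<Sum>x\<in>window N. pi/2 * (c x)\<^sup>2)) {0..pi/2}"
      by (simp only:)
    then show ?thesis
      by (simp add: P_def C_def sum_product sum_distrib_left mult_ac)
  qed
  have hh: "((\<lambda>t. (h t)\<^sup>2) has_integral integral {0..pi/2} (\<lambda>t. (h t)\<^sup>2)) {0..pi/2}"
    by (intro integrable_integral integrable_continuous_real continuous_intros h)
  have "((\<lambda>t. (h t)\<^sup>2 - 2 * (h t * P t) + P t * P t) has_integral
    (integral {0..pi/2} (\<lambda>t. (h t)\<^sup>2) - 2 * (pi/2 * C) + pi/2 * C)) {0..pi/2}"
    by (intro has_integral_add has_integral_diff has_integral_mult_right hh hP PP)
  moreover have "(h t)\<^sup>2 - 2 * (h t * P t) + P t * P t = (h t - P t)\<^sup>2" for t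
    by (simp add: power2_eq_square algebra_simps)
  ultimately have "((\<lambda>t. (h t - P t)\<^sup>2) has_integral
    (integral {0..pi/2} (\<lambda>t. (h t)\<^sup>2) - 2 * (pi/2 * C) + pi/2 * C)) {0..pi/2}"
    by (simp only:)
  then have "0 \<le> integral {0..pi/2} (\<lambda>t. (h t)\<^sup>2) - 2 * (pi/2 * C) + pi/2 * C"
    by (rule has_integral_nonneg) simp
  then have "C * pi \<le> integral {0..pi/2} (\<lambda>t. (h t)\<^sup>2) * 2" by (simp add: mult.commute)
  then show ?thesis by (simp add: C_def c_def field_simps)
qed

lemma cos_coeff_one: "cos_coeff (\<lambda>t. 1) x = of_bool (x = 0)"
  using integral_unique[OF has_integral_cos[of x]] by (simp add: cos_coeff_def)

text \<open>
  The Laplacian acts on cosine coefficients as multiplication by its symbol, by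
  \<open>cos (2(x+1)t) + cos (2(x-1)t) = 2 cos (2xt) cos (2t)\<close>.
\<close>

lemma lap_cos_coeff:
  assumes "h absolutely_integrable_on {0..pi/2}"
  shows "cos_coeff (\<lambda>t. lap_symbol t * h t) x = (cos_coeff h x - cos_coeff h (x + 1)) + (cos_coeff h x - cos_coeff h (x - 1))"
proof -
  have "((\<lambda>t. (h t * cos (2 * of_int x * t) - h t * cos (2 * of_int (x + 1) * t)) +
     (h t * cos (2 * of_int x * t) - h t * cos (2 * of_int (x - 1) * t)))
     has_integral (pi/2 * cos_coeff h x - pi/2 * cos_coeff h (x + 1)) + (pi/2 * cos_coeff h x - pi/2 * cos_coeff h (x - 1))) {0..pi/2}"
    by (intro has_integral_add has_integral_diff has_integral_cos_coeff assms)
  moreover have "(h t * cos (2 * of_int x * t) - h t * cos (2 * of_int (x + 1) * t)) +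
     (h t * cos (2 * of_int x * t) - h t * cos (2 * of_int (x - 1) * t)) = lap_symbol t * h t * cos (2 * of_int x * t)" for t
  proof -
    have "cos (2 * of_int (x + 1) * t) + cos (2 * of_int (x - 1) * t) = 2 * cos (2 * of_int x * t) * cos (2 * t)"
      using cos_add[of "2 * of_int x * t" "2*t"] cos_diff[of "2 * of_int x * t" "2*t"]
      by (simp add: algebra_simps)
    moreover have "2 * cos (2 * t) = 2 - lap_symbol t"
      by (simp add: cos_double_sin lap_symbol_def)
    ultimately have *: "cos (2 * of_int (x + 1) * t) + cos (2 * of_int (x - 1) * t) = cos (2 * of_int x * t) * (2 - lap_symbol t)"
      by (metis mult.assoc mult.commute)
    have "(h t * cos (2 * of_int x * t) - h t * cos (2 * of_int (x + 1) * t)) +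
     (h t * cos (2 * of_int x * t) - h t * cos (2 * of_int (x - 1) * t))
     = h t * (2 * cos (2 * of_int x * t) - (cos (2 * of_int (x + 1) * t) + cos (2 * of_int (x - 1) * t)))"
      by (simp add: algebra_simps)
    then show ?thesis unfolding * by (simp add: algebra_simps)
  qed
  ultimately have "((\<lambda>t. lap_symbol t * h t * cos (2 * of_int x * t)) has_integral
    (pi/2 * cos_coeff h x - pi/2 * cos_coeff h (x + 1)) + (pi/2 * cos_coeff h x - pi/2 * cos_coeff h (x - 1))) {0..pi/2}"
    by simp
  from integral_unique[OF this] show ?thesis
    by (simp add: cos_coeff_def[of "\<lambda>t. lap_symbol t * h t"] field_simps)
qed

lemma continuous_lap_symbol [continuous_intros]: "continuous_on A lap_symbol"
  unfolding lap_symbol_def[abs_def] by (intro continuous_intros)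

lemma cos_coeff_cmult: "c * cos_coeff h x = cos_coeff (\<lambda>t. c * h t) x"
  by (simp add: cos_coeff_def mult.assoc)

lemma cos_coeff_sum:
  assumes "\<And>i. i \<in> I \<Longrightarrow> h i absolutely_integrable_on {0..pi/2}" "finite I"
  shows "cos_coeff (\<lambda>t. \<Sum>i\<in>I. h i t) x = (\<Sum>i\<in>I. cos_coeff (h i) x)"
proof -
  have "((\<lambda>t. \<Sum>i\<in>I. h i t * cos (2 * of_int x * t)) has_integral (\<Sum>i\<in>I. pi/2 * cos_coeff (h i) x)) {0..pi/2}"
    by (intro has_integral_sum has_integral_cos_coeff assms) 
  from integral_unique[OF this] show ?thesis
    by (simp add: cos_coeff_def[of "\<lambda>t. \<Sum>i\<in>I. h i t"] sum_distrib_right sum_distrib_left)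
qed

lemma cos_coeff_diff:
  assumes "f absolutely_integrable_on {0..pi/2}" "g absolutely_integrable_on {0..pi/2}"
  shows "cos_coeff (\<lambda>t. f t - g t) x = cos_coeff f x - cos_coeff g x"
proof -
  have "((\<lambda>t. f t * cos (2 * of_int x * t) - g t * cos (2 * of_int x * t)) has_integral
      (pi/2 * cos_coeff f x - pi/2 * cos_coeff g x)) {0..pi/2}"
    by (intro has_integral_diff has_integral_cos_coeff assms)
  from integral_unique[OF this] show ?thesis
    by (simp add: cos_coeff_def[of "\<lambda>t. f t - g t"] left_diff_distrib) (simp add: field_simps)
qed

section \<open>The functional calculus of the Laplacian\<close>

text \<open>
  Convolution with the cosine coefficients of \<open>h\<close>, that is, the operator with Fourier multiplier
  \<open>h\<close>. Meant for finitely supported functions, for which the sum is finite.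
\<close>

definition multiplier :: "(real \<Rightarrow> real) \<Rightarrow> (int \<Rightarrow> real) \<Rightarrow> int \<Rightarrow> real"
  where "multiplier h \<phi> x = (\<Sum>y | \<phi> y \<noteq> 0. cos_coeff h (x - y) * \<phi> y)"

lemma lap_multiplier:
  assumes "h absolutely_integrable_on {0..pi/2}"
  shows "lap (multiplier h \<phi>) x = multiplier (\<lambda>t. lap_symbol t * h t) \<phi> x"
proof -
  have "x + 1 - y = x - y + 1" "x - 1 - y = x - y - 1" for y by auto
  then show ?thesis
    unfolding lap_def multiplier_def lap_cos_coeff[OF assms]
    by (simp only: left_diff_distrib distrib_right sum_subtractf sum.distrib)
qed

lemma lap_pow:
  assumes "\<phi> \<in> fin_supp"
  shows "(lap ^^ i) \<phi> = multiplier (\<lambda>t. lap_symbol t ^ i) \<phi>"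
proof (induction i)
  case 0
  have *: "(\<Sum>y | \<phi> y \<noteq> 0. of_bool (x - y = 0) * \<phi> y) = \<phi> x" for x
  proof (cases "\<phi> x = 0")
    case True
    then have "(\<Sum>y | \<phi> y \<noteq> 0. of_bool (x - y = 0) * \<phi> y) = 0" by (intro sum.neutral) auto
    then show ?thesis using True by simp
  next
    case False
    then have "(\<Sum>y | \<phi> y \<noteq> 0. of_bool (x - y = 0) * \<phi> y) = (\<Sum>y | \<phi> y \<noteq> 0. if y = x then \<phi> y else 0)"
      by (intro sum.cong) auto
    then show ?thesis using assms False by (simp add: fin_supp_def)
  qed
  show ?case by (rule ext) (simp only: multiplier_def power_0 cos_coeff_one * funpow_0)
next
  case (Suc i)
  have "lap (multiplier (\<lambda>t. lap_symbol t ^ i) \<phi>) x = multiplier (\<lambda>t. lap_symbol t * lap_symbol t ^ i) \<phi> x" for x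
    by (intro lap_multiplier continuous_abs_integrable continuous_intros)
  then show ?case using Suc by auto
qed

lemma lap_poly_multiplier:
  assumes "\<phi> \<in> fin_supp"
  shows "lap_poly p \<phi> x = multiplier (\<lambda>t. poly p (lap_symbol t)) \<phi> x"
proof -
  have a: "(\<lambda>t. lap_symbol t ^ i) absolutely_integrable_on {0..pi/2}" "(\<lambda>t. c * lap_symbol t ^ i) absolutely_integrable_on {0..pi/2}" for i c
    by (intro continuous_abs_integrable continuous_intros)+
  have "lap_poly p \<phi> x = (\<Sum>i\<le>degree p. \<Sum>y | \<phi> y \<noteq> 0. cos_coeff (\<lambda>t. coeff p i * lap_symbol t ^ i) (x - y) * \<phi> y)"
    by (simp add: lap_poly_def lap_pow[OF assms] multiplier_def sum_distrib_left cos_coeff_cmult[of _ "\<lambda>t. lap_symbol t ^ _", symmetric] mult.assoc)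
  also have "\<dots> = (\<Sum>y | \<phi> y \<noteq> 0. \<Sum>i\<le>degree p. cos_coeff (\<lambda>t. coeff p i * lap_symbol t ^ i) (x - y) * \<phi> y)"
    by (rule sum.swap)
  also have "\<dots> = multiplier (\<lambda>t. poly p (lap_symbol t)) \<phi> x"
    unfolding multiplier_def poly_altdef
    by (subst cos_coeff_sum) (auto simp: sum_distrib_right a)
  finally show ?thesis .
qed

text \<open>
  Cauchy-Schwarz over the support of \<open>\<phi>\<close> and the Bessel inequality. The constant grows with
  the support, which is harmless: the lemma serves to pass from uniform convergence of symbols to
  convergence in \<open>\<ell>\<^sup>2\<close> for one fixed \<open>\<phi>\<close>.
\<close>

lemma multiplier_bound:
  fixes \<phi> :: "int \<Rightarrow> real"
  assumes h: "continuous_on {0..pi/2} h"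
  defines "C \<equiv> (\<Sum>y | \<phi> y \<noteq> 0. (\<phi> y)\<^sup>2) * real (card {y. \<phi> y \<noteq> 0}) * (2 / pi * integral {0..pi/2} (\<lambda>t. (h t)\<^sup>2))"
  shows "finite F \<Longrightarrow> (\<Sum>x\<in>F. (multiplier h \<phi> x)\<^sup>2) \<le> C"
proof -
  assume F: "finite F"
  define S where "S = {y. \<phi> y \<noteq> 0}"
  define I where "I = 2 / pi * integral {0..pi/2} (\<lambda>t. (h t)\<^sup>2)"
  have b: "(\<Sum>x\<in>F. (cos_coeff h (x - y))\<^sup>2) \<le> I" for y
  proof -
    obtain N where "(\<lambda>x. x - y) ` F \<subseteq> window N" using finite_subset_window[of "(\<lambda>x. x - y) ` F"] F by auto
    then have "(\<Sum>x\<in>(\<lambda>x. x - y) ` F. (cos_coeff h x)\<^sup>2) \<le> (\<Sum>x\<in>window N. (cos_coeff h x)\<^sup>2)"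
      by (intro sum_mono2) auto
    also have "\<dots> \<le> I" unfolding I_def by (rule cos_coeff_bessel[OF h])
    finally show ?thesis by (simp add: sum.reindex inj_on_def)
  qed
  have "(\<Sum>x\<in>F. (multiplier h \<phi> x)\<^sup>2) \<le> (\<Sum>x\<in>F. (\<Sum>y\<in>S. (cos_coeff h (x - y))\<^sup>2) * (\<Sum>y\<in>S. (\<phi> y)\<^sup>2))"
    unfolding multiplier_def S_def by (intro sum_mono Cauchy_Schwarz_ineq_sum)
  also have "\<dots> = (\<Sum>y\<in>S. (\<phi> y)\<^sup>2) * (\<Sum>y\<in>S. \<Sum>x\<in>F. (cos_coeff h (x - y))\<^sup>2)"
    by (subst sum.swap) (simp add: sum_distrib_left mult.commute)
  also have "\<dots> \<le> (\<Sum>y\<in>S. (\<phi> y)\<^sup>2) * (\<Sum>y\<in>S. I)"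
    by (intro mult_left_mono sum_mono b sum_nonneg) auto
  also have "\<dots> = C" by (simp add: C_def S_def I_def)
  finally show ?thesis .
qed

lemma multiplier_ell2:
  assumes h: "continuous_on {0..pi/2} h"
  shows "multiplier h \<phi> \<in> ell2"
  unfolding ell2_def mem_Collect_eq
proof (rule nonneg_bdd_above_summable_on)
  show "bdd_above (sum (\<lambda>x. (multiplier h \<phi> x)\<^sup>2) ` {F. F \<subseteq> UNIV \<and> finite F})"
  proof (rule bdd_aboveI2)
    fix F :: "int set" assume "F \<in> {F. F \<subseteq> UNIV \<and> finite F}"
    then have "finite F" by simp
    then show "(\<Sum>x\<in>F. (multiplier h \<phi> x)\<^sup>2) \<le> (\<Sum>y | \<phi> y \<noteq> 0. (\<phi> y)\<^sup>2) * real (card {y. \<phi> y \<noteq> 0}) * (2 / pi * integral {0..pi/2} (\<lambda>t. (h t)\<^sup>2))"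
      by (rule multiplier_bound[OF h])
  qed
qed simp

lemma multiplier_norm:
  assumes h: "continuous_on {0..pi/2} h" and e: "\<And>t. t \<in> {0..pi/2} \<Longrightarrow> \<bar>h t\<bar> \<le> e"
  shows "ell2_norm (multiplier h \<phi>) \<le> sqrt ((\<Sum>y | \<phi> y \<noteq> 0. (\<phi> y)\<^sup>2) * real (card {y. \<phi> y \<noteq> 0})) * e"
proof -
  have e0: "0 \<le> e" using e[of 0] by auto
  define K where "K = (\<Sum>y | \<phi> y \<noteq> 0. (\<phi> y)\<^sup>2) * real (card {y. \<phi> y \<noteq> 0})"
  have K: "K \<ge> 0" by (auto simp: K_def intro!: mult_nonneg_nonneg sum_nonneg)
  have "integral {0..pi/2} (\<lambda>t. (h t)\<^sup>2) \<le> integral {0..pi/2} (\<lambda>t. e\<^sup>2)"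
  proof (intro integral_le integrable_continuous_real continuous_intros h)
    fix t assume "t \<in> {0..pi/2}"
    then show "(h t)\<^sup>2 \<le> e\<^sup>2" using e e0 by (intro abs_le_square_iff[THEN iffD1]) simp
  qed
  then have "2 / pi * integral {0..pi/2} (\<lambda>t. (h t)\<^sup>2) \<le> e\<^sup>2"
    by (simp add: field_simps)
  then have le: "K * (2 / pi * integral {0..pi/2} (\<lambda>t. (h t)\<^sup>2)) \<le> K * e\<^sup>2"
    using K by (rule mult_left_mono)
  have "(\<Sum>\<^sub>\<infinity>x. (multiplier h \<phi> x)\<^sup>2) \<le> K * e\<^sup>2"
    using multiplier_bound[OF h, of _ \<phi>] le multiplier_ell2[OF h, of \<phi>]
    by (intro infsum_le_finite_sums) (auto simp: ell2_def K_def intro: order_trans)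
  then have "ell2_norm (multiplier h \<phi>) \<le> sqrt (K * e\<^sup>2)"
    by (simp add: ell2_norm_def)
  then show ?thesis using e0 by (simp add: real_sqrt_mult K_def)
qed

lemma ell2_diff:
  assumes "f \<in> ell2" "g \<in> ell2"
  shows "(\<lambda>x. f x - g x) \<in> ell2"
proof -
  have "(\<lambda>x. 2 * (f x)\<^sup>2 + 2 * (g x)\<^sup>2) summable_on UNIV"
    using assms unfolding ell2_def by (intro summable_on_add summable_on_cmult_right) auto
  moreover have "(f x - g x)\<^sup>2 \<le> 2 * (f x)\<^sup>2 + 2 * (g x)\<^sup>2" for x
    using zero_le_power2[of "f x + g x"] by (simp add: power2_eq_square algebra_simps)
  ultimately show ?thesis unfolding ell2_def mem_Collect_eq
    by (rule summable_on_comparison_test) auto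
qed

lemma abs_le_ell2_norm:
  assumes "f \<in> ell2"
  shows "\<bar>f x\<bar> \<le> ell2_norm f"
proof -
  have "(f x)\<^sup>2 \<le> (\<Sum>\<^sub>\<infinity>x. (f x)\<^sup>2)"
    using finite_sum_le_infsum[of "\<lambda>x. (f x)\<^sup>2" UNIV "{x}"] assms by (simp add: ell2_def)
  then show ?thesis unfolding ell2_norm_def by (intro real_le_rsqrt) simp
qed

lemma poly_uniform_approx:
  fixes g :: "real \<Rightarrow> real"
  assumes "continuous_on {a..b} g"
  obtains p where "uniform_limit {a..b} (\<lambda>n. poly (p n)) g sequentially"
proof -
  obtain q where q: "uniform_limit {a..b} q g sequentially" "\<And>n. polynomial_function (q n)"
    using Stone_Weierstrass_uniform_limit[OF _ assms] by auto
  have "\<exists>P. q n = poly P" for n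
  proof -
    have "real_polynomial_function (q n)" using q(2) by (simp add: real_polynomial_function_eq)
    then obtain c m where "q n = (\<lambda>x. \<Sum>i\<le>m. c i * x ^ i)"
      by (auto simp: real_polynomial_function_iff_sum)
    then have "q n = poly (\<Sum>i\<le>m. monom (c i) i)" by (auto simp: poly_sum poly_monom)
    then show ?thesis by blast
  qed
  then obtain P where P: "\<And>n. q n = poly (P n)" by metis
  then have "q = (\<lambda>n. poly (P n))" by auto
  then show ?thesis using that q by auto
qed

text \<open>
  Polynomials of the Laplacian are multipliers, and multipliers depend continuously on the symbol.
  Uniqueness of the limit needs one approximating sequence of polynomials, which the Weierstrass
  theorem provides.
\<close>

lemma lap_calculus_eq:
  assumes g: "continuous_on {0..4} g" and phi: "\<phi> \<in> fin_supp"
  shows "lap_calculus g \<phi> = multiplier (\<lambda>t. g (lap_symbol t)) \<phi>"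
proof -
  let ?h = "multiplier (\<lambda>t. g (lap_symbol t)) \<phi>"
  define K where "K = sqrt ((\<Sum>y | \<phi> y \<noteq> 0. (\<phi> y)\<^sup>2) * real (card {y. \<phi> y \<noteq> 0}))"
  have K: "K \<ge> 0" by (auto simp: K_def intro!: mult_nonneg_nonneg sum_nonneg)
  have cg: "continuous_on {0..pi/2} (\<lambda>t. g (lap_symbol t))"
    by (intro continuous_on_compose2[OF g] continuous_intros) (use lap_symbol_range in auto)
  have cp: "continuous_on {0..pi/2} (\<lambda>t. poly p (lap_symbol t))" for p
    by (intro continuous_intros)
  have diff: "(\<lambda>x. lap_poly p \<phi> x - ?h x) = multiplier (\<lambda>t. poly p (lap_symbol t) - g (lap_symbol t)) \<phi>" for p
    using cos_coeff_diff[OF continuous_abs_integrable[OF cp] continuous_abs_integrable[OF cg]]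
    by (auto simp: lap_poly_multiplier[OF phi] multiplier_def sum_subtractf left_diff_distrib)
  have conv: "(\<lambda>n. ell2_norm (\<lambda>x. lap_poly (p n) \<phi> x - ?h x)) \<longlonglongrightarrow> 0"
    if ul: "uniform_limit {0..4} (\<lambda>n. poly (p n)) g sequentially" for p
  proof (rule LIMSEQ_I)
    fix r :: real assume r: "r > 0"
    define K' where "K' = K + 1"
    define e where "e = r / (2 * K')"
    have K': "K' > 0" using K by (simp add: K'_def)
    have e: "e > 0" using r K' by (simp add: e_def)
    have "K * e \<le> K' * e" using e by (simp add: K'_def)
    also have "\<dots> = r / 2" using K' by (simp add: e_def)
    finally have Ke: "K * e < r" using r by simp
    obtain N where "\<forall>n\<ge>N. \<forall>s\<in>{0..4}. \<bar>poly (p n) s - g s\<bar> < e"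
      using uniform_limitD[OF ul e] unfolding eventually_sequentially dist_real_def by blast
    then have N: "\<bar>poly (p n) s - g s\<bar> < e" if "n \<ge> N" "s \<in> {0..4}" for n s
      using that by blast
    have "norm (ell2_norm (\<lambda>x. lap_poly (p n) \<phi> x - ?h x) - 0) < r" if "n \<ge> N" for n
    proof -
      have "ell2_norm (\<lambda>x. lap_poly (p n) \<phi> x - ?h x) \<le> K * e"
        unfolding diff K_def
      proof (rule multiplier_norm)
        show "continuous_on {0..pi/2} (\<lambda>t. poly (p n) (lap_symbol t) - g (lap_symbol t))"
          by (intro continuous_on_diff cg cp)
        show "\<bar>poly (p n) (lap_symbol t) - g (lap_symbol t)\<bar> \<le> e" for t
          using N[OF \<open>n \<ge> N\<close> lap_symbol_range] by (rule less_imp_le)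
      qed
      moreover have "0 \<le> ell2_norm (\<lambda>x. lap_poly (p n) \<phi> x - ?h x)"
        by (auto simp: ell2_norm_def intro!: infsum_nonneg)
      ultimately show ?thesis using Ke by simp
    qed
    then show "\<exists>N. \<forall>n\<ge>N. norm (ell2_norm (\<lambda>x. lap_poly (p n) \<phi> x - ?h x) - 0) < r" by blast
  qed
  show ?thesis unfolding lap_calculus_def
  proof (rule the_equality)
    show "?h \<in> ell2 \<and> (\<forall>p. uniform_limit {0..4} (\<lambda>n. poly (p n)) g sequentially \<longrightarrow>
           (\<lambda>n. ell2_norm (\<lambda>x. lap_poly (p n) \<phi> x - ?h x)) \<longlonglongrightarrow> 0)"
      using conv multiplier_ell2[OF cg] by blast
  next
    fix k assume k: "k \<in> ell2 \<and> (\<forall>p. uniform_limit {0..4} (\<lambda>n. poly (p n)) g sequentially \<longrightarrow>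
           (\<lambda>n. ell2_norm (\<lambda>x. lap_poly (p n) \<phi> x - k x)) \<longlonglongrightarrow> 0)"
    obtain p where p: "uniform_limit {0..4} (\<lambda>n. poly (p n)) g sequentially"
      using poly_uniform_approx[OF g] .
    have lim: "(\<lambda>n. lap_poly (p n) \<phi> x) \<longlonglongrightarrow> f x"
      if "f \<in> ell2" "(\<lambda>n. ell2_norm (\<lambda>x. lap_poly (p n) \<phi> x - f x)) \<longlonglongrightarrow> 0" for f x
    proof -
      have "(\<lambda>x. lap_poly (p n) \<phi> x - f x) \<in> ell2" for n
        unfolding lap_poly_multiplier[OF phi] by (intro ell2_diff multiplier_ell2 cp that(1))
      then have "\<bar>lap_poly (p n) \<phi> x - f x\<bar> \<le> ell2_norm (\<lambda>x. lap_poly (p n) \<phi> x - f x)" for n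
        using abs_le_ell2_norm by blast
      then have "(\<lambda>n. lap_poly (p n) \<phi> x - f x) \<longlonglongrightarrow> 0"
        by (intro Lim_null_comparison[OF _ that(2)]) auto
      then show ?thesis by (simp add: LIM_zero_iff)
    qed
    show "k = ?h"
    proof
      fix x
      show "k x = ?h x"
        by (rule LIMSEQ_unique[OF lim[of k x] lim[of ?h x]])
           (use k p in blast, use k p in blast, rule multiplier_ell2[OF cg], rule conv[OF p])
    qed
  qed
qed

section \<open>Fourier inversion and products of symbols\<close>

lemma cos_coeff_mult_poly_lap_symbol_eq_0:
  assumes h: "continuous_on {0..pi/2} h" and z: "\<And>x. cos_coeff h x = 0"
  shows "cos_coeff (\<lambda>t. poly p (lap_symbol t) * h t) x = 0"
proof -
  have c: "(\<lambda>t. lap_symbol t ^ i * h t) absolutely_integrable_on {0..pi/2}"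
    "(\<lambda>t. c * (lap_symbol t ^ i * h t)) absolutely_integrable_on {0..pi/2}" for i c
    by (intro continuous_abs_integrable continuous_intros h)+
  have pow: "cos_coeff (\<lambda>t. lap_symbol t ^ i * h t) x = 0" for i x
  proof (induction i arbitrary: x)
    case 0
    then show ?case by (simp add: z)
  next
    case (Suc i)
    then show ?case using lap_cos_coeff[OF c(1)[of i], of x] by (simp add: mult.assoc)
  qed
  have "cos_coeff (\<lambda>t. poly p (lap_symbol t) * h t) x = cos_coeff (\<lambda>t. \<Sum>i\<le>degree p. coeff p i * (lap_symbol t ^ i * h t)) x"
    by (simp add: poly_altdef sum_distrib_right mult.assoc)
  also have "\<dots> = (\<Sum>i\<le>degree p. coeff p i * cos_coeff (\<lambda>t. lap_symbol t ^ i * h t) x)"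
    by (subst cos_coeff_sum) (auto simp: c cos_coeff_cmult)
  finally show ?thesis by (simp add: pow)
qed

text \<open>
  On \<open>[0, \<pi>/2]\<close> the symbol is injective, so \<open>h\<close> is a continuous function of the symbol and a
  uniform limit of polynomials in it. Being orthogonal to all of these, \<open>h\<close> is orthogonal to
  itself.
\<close>

lemma cos_coeff_inj:
  assumes h: "continuous_on {0..pi/2} h" and z: "\<And>x. cos_coeff h x = 0" and t: "t \<in> {0..pi/2}"
  shows "h t = 0"
proof -
  define arc where "arc = (\<lambda>s. arcsin (sqrt s / 2))"
  have sq: "sqrt s / 2 \<in> {0..1}" if "s \<in> {0..4}" for s :: real
    using that real_sqrt_le_mono[of s 4] by auto
  have arc: "arc s \<in> {0..pi/2}" if "s \<in> {0..4}" for s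
  proof -
    have "0 \<le> arcsin (sqrt s / 2)" using sq[OF that] arcsin_le_arcsin[of 0 "sqrt s / 2"] by auto
    moreover have "arcsin (sqrt s / 2) \<le> pi/2" using sq[OF that] arcsin_bounded[of "sqrt s / 2"] order_trans[of "-1" 0 "sqrt s / 2"] by auto
    ultimately show ?thesis by (simp add: arc_def)
  qed
  have arc_lap_symbol: "arc (lap_symbol t) = t" if "t \<in> {0..pi/2}" for t
  proof -
    have "0 \<le> sin t" using that by (intro sin_ge_zero) auto
    then have "sqrt (lap_symbol t) = 2 * sin t" by (simp add: lap_symbol_def real_sqrt_mult)
    then show ?thesis using that by (simp add: arc_def arcsin_sin)
  qed
  have "-1 \<le> sqrt s / 2 \<and> sqrt s / 2 \<le> 1" if "s \<in> {0..4}" for s :: real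
    using sq[OF that] order_trans[of "-1" 0 "sqrt s / 2"] by auto
  then have "continuous_on {0..4} arc"
    unfolding arc_def by (intro continuous_intros) auto
  then have "continuous_on {0..4} (\<lambda>s. h (arc s))"
    by (rule continuous_on_compose2[OF h]) (use arc in auto)
  then obtain p where p: "uniform_limit {0..4} (\<lambda>n. poly (p n)) (\<lambda>s. h (arc s)) sequentially"
    by (rule poly_uniform_approx)
  define I where "I = integral {0..pi/2} (\<lambda>t. (h t)\<^sup>2)"
  define M where "M = integral {0..pi/2} (\<lambda>t. \<bar>h t\<bar>)"
  have M0: "0 \<le> M" unfolding M_def by (intro integral_nonneg integrable_continuous_real continuous_intros h) auto
  have le: "I \<le> e * M" if e: "e > 0" for e
  proof -
    obtain n where "\<forall>s\<in>{0..4}. \<bar>poly (p n) s - h (arc s)\<bar> < e"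
      using uniform_limitD[OF p e] unfolding eventually_sequentially dist_real_def by blast
    then have n: "\<bar>poly (p n) s - h (arc s)\<bar> < e" if "s \<in> {0..4}" for s
      using that by blast
    have b: "\<bar>h t - poly (p n) (lap_symbol t)\<bar> \<le> e" if "t \<in> {0..pi/2}" for t
      using n[OF lap_symbol_range, of t] arc_lap_symbol[OF that] by (simp add: abs_minus_commute)
    have c: "continuous_on {0..pi/2} (\<lambda>t. poly (p n) (lap_symbol t) * h t)"
      by (intro continuous_intros h)
    have "integral {0..pi/2} (\<lambda>t. poly (p n) (lap_symbol t) * h t) = 0"
      using cos_coeff_mult_poly_lap_symbol_eq_0[OF h z, of "p n" 0] by (simp add: cos_coeff_def)
    then have "I = integral {0..pi/2} (\<lambda>t. (h t)\<^sup>2 - poly (p n) (lap_symbol t) * h t)"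
      unfolding I_def
      by (subst Henstock_Kurzweil_Integration.integral_diff) (auto intro!: integrable_continuous_real continuous_intros h c)
    also have "\<dots> \<le> integral {0..pi/2} (\<lambda>t. e * \<bar>h t\<bar>)"
    proof (intro integral_le integrable_continuous_real continuous_intros h)
      fix t assume t: "t \<in> {0..pi/2}"
      have "(h t)\<^sup>2 - poly (p n) (lap_symbol t) * h t = (h t - poly (p n) (lap_symbol t)) * h t"
        by (simp add: power2_eq_square algebra_simps)
      also have "\<dots> \<le> \<bar>h t - poly (p n) (lap_symbol t)\<bar> * \<bar>h t\<bar>" by (metis abs_ge_self abs_mult)
      also have "\<dots> \<le> e * \<bar>h t\<bar>" using b[OF t] by (intro mult_right_mono) auto
      finally show "(h t)\<^sup>2 - poly (p n) (lap_symbol t) * h t \<le> e * \<bar>h t\<bar>" .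
    qed
    finally show ?thesis by (simp add: M_def)
  qed
  have "I \<le> 0"
  proof (rule ccontr)
    assume "\<not> I \<le> 0"
    then have I: "I > 0" by simp
    have "I \<le> I / (M + 1) * M" using I M0 by (intro le) auto
    then have "I * (M + 1) \<le> I * M" using M0 by (simp add: field_simps)
    then show False using I by (simp add: algebra_simps)
  qed
  moreover have "0 \<le> I" unfolding I_def by (intro integral_nonneg integrable_continuous_real continuous_intros h) auto
  ultimately have "I = 0" by simp
  then have "\<forall>t\<in>{0..pi/2}. (h t)\<^sup>2 = 0"
    unfolding I_def by (subst (asm) integral_eq_0_iff) (auto intro!: continuous_intros h)
  then show ?thesis using t by simp
qed

lemma cos_series_summable:
  fixes c :: "int \<Rightarrow> real"
  assumes c: "(\<lambda>z. \<bar>c z\<bar>) summable_on UNIV"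
  shows "(\<lambda>z. c z * cos (2 * of_int z * t)) summable_on UNIV"
  by (rule abs_summable_summable, rule summable_on_comparison_test[OF c]) (auto simp: abs_mult mult_left_le)

lemma cos_series_uniform:
  fixes c :: "int \<Rightarrow> real"
  assumes c: "(\<lambda>z. \<bar>c z\<bar>) summable_on UNIV"
  shows "uniform_limit A (\<lambda>N t. (\<Sum>z\<in>window N. c z * cos (2 * of_int z * t)) * cos (b * t))
     (\<lambda>t. (\<Sum>\<^sub>\<infinity>z. c z * cos (2 * of_int z * t)) * cos (b * t)) sequentially"
proof -
  have "uniform_limit A (\<lambda>X t. \<Sum>z\<in>X. c z * cos (2 * of_int z * t) * cos (b * t))
     (\<lambda>t. \<Sum>\<^sub>\<infinity>z. c z * cos (2 * of_int z * t) * cos (b * t)) (finite_subsets_at_top UNIV)"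
    by (rule Weierstrass_m_test_general[OF _ c]) (auto simp: abs_mult mult.assoc intro!: mult_left_le mult_le_one)
  then have "uniform_limit A (\<lambda>N t. \<Sum>z\<in>window N. c z * cos (2 * of_int z * t) * cos (b * t))
     (\<lambda>t. \<Sum>\<^sub>\<infinity>z. c z * cos (2 * of_int z * t) * cos (b * t)) sequentially"
    by (rule filterlim_compose[OF _ filterlim_window])
  moreover have "(\<Sum>\<^sub>\<infinity>z. c z * cos (2 * of_int z * t) * cos (b * t)) = (\<Sum>\<^sub>\<infinity>z. c z * cos (2 * of_int z * t)) * cos (b * t)" for t
    by (rule infsum_cmult_left')
  ultimately show ?thesis by (simp add: sum_distrib_right)
qed

lemma cos_coeff_cos_series:
  fixes c :: "int \<Rightarrow> real"
  assumes c: "(\<lambda>z. \<bar>c z\<bar>) summable_on UNIV" and even: "\<And>z. c (- z) = c z"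
  shows "cos_coeff (\<lambda>t. \<Sum>\<^sub>\<infinity>z. c z * cos (2 * of_int z * t)) x = c x"
proof -
  define F where "F = (\<lambda>t. \<Sum>\<^sub>\<infinity>z. c z * cos (2 * of_int z * t))"
  obtain I J where
    I: "\<And>N. ((\<lambda>t. (\<Sum>z\<in>window N. c z * cos (2 * of_int z * t)) * cos (2 * of_int x * t)) has_integral I N) {0..pi/2}"
    and J: "((\<lambda>t. F t * cos (2 * of_int x * t)) has_integral J) {0..pi/2}" and IJ: "I \<longlonglongrightarrow> J"
    unfolding F_def
    by (rule uniform_limit_integral[OF cos_series_uniform[OF c, where A="{0..pi/2}" and b="2 * of_int x"]])
       (auto intro!: continuous_intros)
  have "I N = pi/2 * c x" if "nat \<bar>x\<bar> \<le> N" for N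
  proof -
    have x: "x \<in> window N" "- x \<in> window N" using that by auto
    have "((\<lambda>t. \<Sum>z\<in>window N. c z * (cos (2 * of_int x * t) * cos (2 * of_int z * t))) has_integral
      (\<Sum>z\<in>window N. c z * (pi/4 * (of_bool (z = - x) + of_bool (z = x))))) {0..pi/2}"
      by (intro has_integral_sum has_integral_mult_right has_integral_cos_cos) auto
    moreover have "(\<Sum>z\<in>window N. c z * (pi/4 * (of_bool (z = - x) + of_bool (z = x)))) = pi/2 * c x"
    proof -
      have "(\<Sum>z\<in>window N. c z * (pi/4 * (of_bool (z = - x) + of_bool (z = x))))
        = (\<Sum>z\<in>window N. (if z = - x then c z * pi/4 else 0)) + (\<Sum>z\<in>window N. (if z = x then c z * pi/4 else 0))"
        by (subst sum.distrib[symmetric]) (auto intro!: sum.cong)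
      also have "\<dots> = c (- x) * pi/4 + c x * pi/4"
        using x by (simp add: sum.delta)
      finally show ?thesis by (simp add: even)
    qed
    moreover have "(\<Sum>z\<in>window N. c z * (cos (2 * of_int x * t) * cos (2 * of_int z * t)))
      = (\<Sum>z\<in>window N. c z * cos (2 * of_int z * t)) * cos (2 * of_int x * t)" for t :: real
      unfolding sum_distrib_right by (intro sum.cong refl) (simp add: mult_ac)
    ultimately have "((\<lambda>t. (\<Sum>z\<in>window N. c z * cos (2 * of_int z * t)) * cos (2 * of_int x * t)) has_integral pi/2 * c x) {0..pi/2}"
      by (simp only:)
    with I[of N] show ?thesis by (rule has_integral_unique)
  qed
  then have "eventually (\<lambda>N. I N = pi/2 * c x) sequentially"
    unfolding eventually_sequentially by blast
  then have "I \<longlonglongrightarrow> pi/2 * c x" by (rule tendsto_eventually)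
  with IJ have "J = pi/2 * c x" by (rule LIMSEQ_unique)
  with integral_unique[OF J] have "integral {0..pi/2} (\<lambda>t. F t * cos (2 * of_int x * t)) = pi/2 * c x" by simp
  then have "cos_coeff F x = c x" unfolding cos_coeff_def by (simp only:) simp
  then show ?thesis by (simp add: F_def)
qed

text \<open>
  By absolute convergence the series is a continuous function with the same coefficients as
  \<open>h\<close>.
\<close>

lemma fourier_inversion:
  assumes h: "continuous_on {0..pi/2} h" and c: "(\<lambda>z. \<bar>cos_coeff h z\<bar>) summable_on UNIV"
    and t: "t \<in> {0..pi/2}"
  shows "((\<lambda>z. cos_coeff h z * cos (2 * of_int z * t)) has_sum h t) UNIV"
proof -
  define F where "F = (\<lambda>t. \<Sum>\<^sub>\<infinity>z. cos_coeff h z * cos (2 * of_int z * t))"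
  have F: "continuous_on {0..pi/2} F"
  proof (rule uniform_limit_theorem)
    show "uniform_limit {0..pi/2} (\<lambda>N t. \<Sum>z\<in>window N. cos_coeff h z * cos (2 * of_int z * t)) F sequentially"
      using cos_series_uniform[OF c, where A="{0..pi/2}" and b=0] by (simp add: F_def)
    show "eventually (\<lambda>N. continuous_on {0..pi/2} (\<lambda>t. \<Sum>z\<in>window N. cos_coeff h z * cos (2 * of_int z * t))) sequentially"
      by (intro always_eventually allI continuous_intros)
  qed auto
  have "cos_coeff (\<lambda>t. h t - F t) x = 0" for x
    using cos_coeff_cos_series[OF c cos_coeff_minus, of x]
    by (subst cos_coeff_diff) (auto intro!: continuous_abs_integrable h F simp: F_def[symmetric])
  then have "h t - F t = 0"
    by (intro cos_coeff_inj[of "\<lambda>t. h t - F t"] continuous_intros h F t)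
  then have "h t = (\<Sum>\<^sub>\<infinity>z. cos_coeff h z * cos (2 * of_int z * t))" by (simp add: F_def)
  then show ?thesis using cos_series_summable[OF c] by (simp add: has_sum_infsum)
qed

lemma sum_window_odd:
  fixes f :: "int \<Rightarrow> real"
  assumes "\<And>z. f (- z) = - f z"
  shows "(\<Sum>z\<in>window N. f z) = 0"
proof -
  have "(\<Sum>z\<in>window N. f z) = (\<Sum>z\<in>window N. f (- z))"
    by (rule sum.reindex_bij_witness[of _ uminus uminus]) auto
  then show ?thesis by (simp add: assms sum_negf)
qed

text \<open>
  The partial sums of the Fourier series of \<open>h\<close> convolve with the coefficients of \<open>q\<close>
  by an addition theorem, and dominated convergence with the majorant \<open>M \<bar>q\<bar>\<close> gives the
  limit. The factor \<open>q\<close> is only integrable, like the negative powers of the symbol.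
\<close>

lemma cos_coeff_mult:
  assumes h: "continuous_on {0..pi/2} h" and c: "(\<lambda>z. \<bar>cos_coeff h z\<bar>) summable_on UNIV"
    and q: "q absolutely_integrable_on {0..pi/2}"
  shows "((\<lambda>z. cos_coeff h z * cos_coeff q (x - z)) has_sum cos_coeff (\<lambda>t. h t * q t) x) UNIV"
proof -
  define M where "M = (\<Sum>\<^sub>\<infinity>z. \<bar>cos_coeff h z\<bar>)"
  define Q where "Q = 2 / pi * integral {0..pi/2} (\<lambda>t. \<bar>q t\<bar>)"
  define S where "S = (\<lambda>N t. \<Sum>z\<in>window N. cos_coeff h z * cos (2 * of_int z * t))"
  have sm: "(\<lambda>z. cos_coeff h z * cos_coeff q (x - z)) summable_on UNIV"
  proof (rule abs_summable_summable, rule summable_on_comparison_test)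
    show "(\<lambda>z. \<bar>cos_coeff h z\<bar> * Q) summable_on UNIV" by (intro summable_on_cmult_left c)
    show "norm (cos_coeff h z * cos_coeff q (x - z)) \<le> \<bar>cos_coeff h z\<bar> * Q" for z
      using mult_left_mono[OF cos_coeff_abs_le[OF q, of "x - z"], of "\<bar>cos_coeff h z\<bar>"] by (simp add: abs_mult Q_def)
  qed simp
  have SM: "\<bar>S N t\<bar> \<le> M" for N t
  proof -
    have "\<bar>S N t\<bar> \<le> (\<Sum>z\<in>window N. \<bar>cos_coeff h z * cos (2 * of_int z * t)\<bar>)"
      unfolding S_def by (rule sum_abs)
    also have "\<dots> \<le> (\<Sum>z\<in>window N. \<bar>cos_coeff h z\<bar>)"
      by (intro sum_mono) (auto simp: abs_mult mult_left_le)
    also have "\<dots> \<le> M" unfolding M_def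
      by (rule finite_sum_le_infsum[OF c]) auto
    finally show ?thesis .
  qed
  have St: "(\<lambda>N. S N t) \<longlonglongrightarrow> h t" if "t \<in> {0..pi/2}" for t
    using filterlim_compose[OF fourier_inversion[OF h c that, unfolded has_sum_def] filterlim_window]
    by (simp add: S_def)
  have part: "((\<lambda>t. q t * cos (2 * of_int x * t) * S N t) has_integral
    (\<Sum>z\<in>window N. cos_coeff h z * (pi/2 * cos_coeff q (x - z)))) {0..pi/2}" for N
  proof -
    have "((\<lambda>t. \<Sum>z\<in>window N. cos_coeff h z * (q t * cos (2 * of_int (x - z) * t))) has_integral
      (\<Sum>z\<in>window N. cos_coeff h z * (pi/2 * cos_coeff q (x - z)))) {0..pi/2}"
      by (intro has_integral_sum has_integral_mult_right has_integral_cos_coeff q) auto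
    moreover have "(\<Sum>z\<in>window N. cos_coeff h z * (q t * cos (2 * of_int (x - z) * t))) = q t * cos (2 * of_int x * t) * S N t" for t
    proof -
      have "cos_coeff h z * (q t * cos (2 * of_int (x - z) * t)) =
        q t * cos (2 * of_int x * t) * (cos_coeff h z * cos (2 * of_int z * t))
        + q t * sin (2 * of_int x * t) * (cos_coeff h z * sin (2 * of_int z * t))" for z
        using cos_diff[of "2 * of_int x * t" "2 * of_int z * t"] by (simp add: algebra_simps)
      then have "(\<Sum>z\<in>window N. cos_coeff h z * (q t * cos (2 * of_int (x - z) * t)))
        = q t * cos (2 * of_int x * t) * S N t
        + q t * sin (2 * of_int x * t) * (\<Sum>z\<in>window N. cos_coeff h z * sin (2 * of_int z * t))"
        by (simp add: sum.distrib S_def sum_distrib_left)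
      also have "(\<Sum>z\<in>window N. cos_coeff h z * sin (2 * of_int z * t)) = 0"
        by (rule sum_window_odd) (simp add: cos_coeff_minus)
      finally show ?thesis by simp
    qed
    ultimately show ?thesis by (simp only:)
  qed
  have aq: "(\<lambda>t. \<bar>q t\<bar>) integrable_on {0..pi/2}" using q by (simp add: absolutely_integrable_on_def)
  have "(\<lambda>N. integral {0..pi/2} (\<lambda>t. q t * cos (2 * of_int x * t) * S N t)) \<longlonglongrightarrow>
     integral {0..pi/2} (\<lambda>t. q t * cos (2 * of_int x * t) * h t)"
  proof (rule dominated_convergence(2)[of _ _ "\<lambda>t. \<bar>q t\<bar> * M"])
    show "(\<lambda>t. q t * cos (2 * of_int x * t) * S N t) integrable_on {0..pi/2}" for N
      using part by blast
    show "(\<lambda>t. \<bar>q t\<bar> * M) integrable_on {0..pi/2}" using aq by (rule integrable_on_mult_left)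
    show "norm (q t * cos (2 * of_int x * t) * S N t) \<le> \<bar>q t\<bar> * M" for N t
      using SM[of N t] mult_mono[of "\<bar>cos (2 * of_int x * t)\<bar>" 1 "\<bar>S N t\<bar>" M]
      by (auto simp: abs_mult mult.assoc intro!: mult_left_mono)
    show "(\<lambda>N. q t * cos (2 * of_int x * t) * S N t) \<longlonglongrightarrow> q t * cos (2 * of_int x * t) * h t"
      if "t \<in> {0..pi/2}" for t
      by (intro tendsto_mult_left St that)
  qed
  then have "(\<lambda>N. 2 / pi * (\<Sum>z\<in>window N. cos_coeff h z * (pi/2 * cos_coeff q (x - z)))) \<longlonglongrightarrow>
     2 / pi * integral {0..pi/2} (\<lambda>t. q t * cos (2 * of_int x * t) * h t)"
    unfolding integral_unique[OF part] by (rule tendsto_mult_left)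
  moreover have "2 / pi * (\<Sum>z\<in>window N. cos_coeff h z * (pi/2 * cos_coeff q (x - z))) = (\<Sum>z\<in>window N. cos_coeff h z * cos_coeff q (x - z))" for N
    by (simp add: sum_distrib_left)
  moreover have "2 / pi * integral {0..pi/2} (\<lambda>t. q t * cos (2 * of_int x * t) * h t) = cos_coeff (\<lambda>t. h t * q t) x"
    by (simp add: cos_coeff_def mult_ac)
  ultimately have "(\<lambda>N. \<Sum>z\<in>window N. cos_coeff h z * cos_coeff q (x - z)) \<longlonglongrightarrow> cos_coeff (\<lambda>t. h t * q t) x"
    by simp
  moreover have "(\<lambda>N. \<Sum>z\<in>window N. cos_coeff h z * cos_coeff q (x - z)) \<longlonglongrightarrow> (\<Sum>\<^sub>\<infinity>z. cos_coeff h z * cos_coeff q (x - z))"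
    using filterlim_compose[OF infsum_tendsto[OF sm] filterlim_window] .
  ultimately have "cos_coeff (\<lambda>t. h t * q t) x = (\<Sum>\<^sub>\<infinity>z. cos_coeff h z * cos_coeff q (x - z))"
    by (rule LIMSEQ_unique)
  with has_sum_infsum[OF sm] show ?thesis by simp
qed

section \<open>The kernel of the fractional Laplacian\<close>

lemma nn_integral_exp_powr:
  assumes r: "r > 0" and s: "\<sigma> < 1"
  shows "(\<integral>\<^sup>+u. ennreal (indicator {0..} u * (exp (- (u * r)) * u powr (- \<sigma>))) \<partial>lborel)
    = ennreal (r powr (\<sigma> - 1) * Gamma (1 - \<sigma>))"
proof -
  define I where "I = (\<integral>\<^sup>+u. ennreal (indicator {0..} u * (exp (- (u * r)) * u powr (- \<sigma>))) \<partial>lborel)"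
  have "ennreal (Gamma (1 - \<sigma>)) = (\<integral>\<^sup>+t. ennreal (indicator {0..} t * t powr (1 - \<sigma> - 1) / exp t) \<partial>lborel)"
    using s by (intro Gamma_conv_nn_integral_real) simp
  also have "\<dots> = ennreal \<bar>r\<bar> * (\<integral>\<^sup>+u. ennreal (indicator {0..} (0 + r * u) * (0 + r * u) powr (1 - \<sigma> - 1) / exp (0 + r * u)) \<partial>lborel)"
    using r by (intro nn_integral_real_affine) auto
  also have "(\<integral>\<^sup>+u. ennreal (indicator {0..} (0 + r * u) * (0 + r * u) powr (1 - \<sigma> - 1) / exp (0 + r * u)) \<partial>lborel)
    = (\<integral>\<^sup>+u. ennreal (r powr (- \<sigma>)) * ennreal (indicator {0..} u * (exp (- (u * r)) * u powr (- \<sigma>))) \<partial>lborel)"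
  proof (intro nn_integral_cong)
    fix u :: real
    show "ennreal (indicator {0..} (0 + r * u) * (0 + r * u) powr (1 - \<sigma> - 1) / exp (0 + r * u))
      = ennreal (r powr (- \<sigma>)) * ennreal (indicator {0..} u * (exp (- (u * r)) * u powr (- \<sigma>)))"
    proof (cases "u \<ge> 0")
      case True
      then show ?thesis using r
        by (subst ennreal_mult'[symmetric]) (auto simp: powr_mult exp_minus field_simps)
    next
      case False
      then have "\<not> 0 \<le> r * u" using r by (simp add: zero_le_mult_iff)
      then show ?thesis using False by simp
    qed
  qed
  also have "\<dots> = ennreal (r powr (- \<sigma>)) * I"
    unfolding I_def by (intro nn_integral_cmult) auto
  finally have *: "ennreal (Gamma (1 - \<sigma>)) = ennreal (r * r powr (- \<sigma>)) * I"
    using r by (simp add: ennreal_mult mult.assoc)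
  have "r powr (\<sigma> - 1) * (r * r powr (- \<sigma>)) = 1"
    using r by (simp add: powr_diff powr_minus field_simps)
  then have "I = ennreal (r powr (\<sigma> - 1)) * (ennreal (r * r powr (- \<sigma>)) * I)"
    using r by (simp add: mult.assoc[symmetric] ennreal_mult[symmetric])
  also have "\<dots> = ennreal (r powr (\<sigma> - 1)) * ennreal (Gamma (1 - \<sigma>))"
    by (simp only: *[symmetric])
  also have "\<dots> = ennreal (r powr (\<sigma> - 1) * Gamma (1 - \<sigma>))"
    using s by (intro ennreal_mult[symmetric]) (auto intro!: less_imp_le[OF Gamma_real_pos])
  finally show ?thesis by (simp add: I_def)
qed

text \<open>
  Write \<open>1 - exp (- t r)\<close> as the integral of \<open>r exp (- u r)\<close> over \<open>0 \<le> u \<le> t\<close>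
  and exchange the two integrations: the inner integral over \<open>t \<ge> u\<close> is elementary, the outer
  one is a Gamma integral.
\<close>

lemma nn_integral_one_minus_exp:
  assumes r: "r > 0" and s: "0 < \<sigma>" "\<sigma> < 1"
  shows "(\<integral>\<^sup>+t. ennreal (indicator {0<..} t * ((1 - exp (- (t * r))) / t powr (1 + \<sigma>))) \<partial>lborel)
    = ennreal (Gamma (1 - \<sigma>) / \<sigma> * r powr \<sigma>)"
proof -
  define k where "k = (\<lambda>(u::real, t::real). ennreal (indicator {0<..} u * of_bool (u \<le> t) * (r * exp (- (u * r)) / t powr (1 + \<sigma>))))"
  have k: "k \<in> borel_measurable (lborel \<Otimes>\<^sub>M lborel)"
    unfolding k_def by measurable
  have t_part: "(\<integral>\<^sup>+t. k (u, t) \<partial>lborel) = ennreal (r / \<sigma> * (indicator {0..} u * (exp (- (u * r)) * u powr (- \<sigma>))))" for u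
  proof (cases "u > 0")
    case True
    define F where "F = (\<lambda>t. - (r / \<sigma> * exp (- (u * r)) * t powr (- \<sigma>)))"
    have "(\<integral>\<^sup>+t. k (u, t) \<partial>lborel) = (\<integral>\<^sup>+t. ennreal (r * exp (- (u * r)) / t powr (1 + \<sigma>)) * indicator {u..} t \<partial>lborel)"
      using True by (intro nn_integral_cong) (auto simp: k_def split: split_indicator)
    also have "\<dots> = ennreal (0 - F u)"
    proof (rule nn_integral_FTC_atLeast)
      show "((\<lambda>t. F t) \<longlongrightarrow> 0) at_top"
      proof -
        have "((\<lambda>t. t powr (- \<sigma>)) \<longlongrightarrow> 0) at_top"
          using s by (intro tendsto_neg_powr filterlim_ident) auto
        from tendsto_mult_right[OF this, of "- (r / \<sigma> * exp (- (u * r)))"] show ?thesis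
          by (simp add: F_def mult.commute)
      qed
      fix t assume "u \<le> t"
      then have t: "t > 0" using True by simp
      show "DERIV F t :> r * exp (- (u * r)) / t powr (1 + \<sigma>)"
        unfolding F_def using t s
        by (auto intro!: derivative_eq_intros simp: powr_minus powr_diff powr_add field_simps)
      show "0 \<le> r * exp (- (u * r)) / t powr (1 + \<sigma>)" using r by simp
    qed auto
    finally show ?thesis using True by (simp add: F_def mult.assoc)
  next
    case False
    then have "k (u, t) = 0" for t by (simp add: k_def)
    moreover have "u = 0 \<or> u < 0" using False by auto
    ultimately show ?thesis by auto
  qed
  have u_part: "(\<integral>\<^sup>+u. k (u, t) \<partial>lborel) = ennreal (indicator {0<..} t * ((1 - exp (- (t * r))) / t powr (1 + \<sigma>)))" for t
  proof (cases "t > 0")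
    case True
    have "(\<integral>\<^sup>+u. k (u, t) \<partial>lborel) = (\<integral>\<^sup>+u. ennreal (r * exp (- (u * r)) / t powr (1 + \<sigma>)) * indicator {0..t} u \<partial>lborel)"
    proof (intro nn_integral_cong_AE)
      show "AE u in lborel. k (u, t) = ennreal (r * exp (- (u * r)) / t powr (1 + \<sigma>)) * indicator {0..t} u"
        using AE_lborel_singleton[of 0]
        by eventually_elim (auto simp: k_def split: split_indicator)
    qed
    also have "\<dots> = ennreal (- exp (- (t * r)) / t powr (1 + \<sigma>) - (- exp (- (0 * r)) / t powr (1 + \<sigma>)))"
      using True r
      by (intro nn_integral_FTC_Icc[of _ _ _ "\<lambda>u. - exp (- (u * r)) / t powr (1 + \<sigma>)"])
         (auto intro!: derivative_eq_intros)
    finally show ?thesis using True by (simp add: diff_divide_distrib)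
  next
    case False
    then have "k (u, t) = 0" for u by (auto simp: k_def indicator_def)
    then show ?thesis using False by simp
  qed
  have "(\<integral>\<^sup>+t. ennreal (indicator {0<..} t * ((1 - exp (- (t * r))) / t powr (1 + \<sigma>))) \<partial>lborel)
    = (\<integral>\<^sup>+t. (\<integral>\<^sup>+u. k (u, t) \<partial>lborel) \<partial>lborel)"
    by (simp only: u_part)
  also have "\<dots> = (\<integral>\<^sup>+u. (\<integral>\<^sup>+t. k (u, t) \<partial>lborel) \<partial>lborel)"
    by (rule lborel_pair.Fubini[OF k])
  also have "\<dots> = (\<integral>\<^sup>+u. ennreal (r / \<sigma>) * ennreal (indicator {0..} u * (exp (- (u * r)) * u powr (- \<sigma>))) \<partial>lborel)"
    using r s by (simp only: t_part ennreal_mult' divide_nonneg_pos less_imp_le)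
  also have "\<dots> = ennreal (r / \<sigma>) * ennreal (r powr (\<sigma> - 1) * Gamma (1 - \<sigma>))"
    using r s by (subst nn_integral_cmult) (auto simp: nn_integral_exp_powr)
  also have "\<dots> = ennreal (Gamma (1 - \<sigma>) / \<sigma> * r powr \<sigma>)"
    using r s by (subst ennreal_mult'[symmetric]) (auto simp: powr_diff field_simps)
  finally show ?thesis .
qed

lemma has_bochner_integral_one_minus_exp:
  fixes r :: real
  assumes r: "r \<ge> 0" and s: "0 < \<sigma>" "\<sigma> < 1"
  shows "has_bochner_integral lborel (\<lambda>t. indicator {0<..} t * ((1 - exp (- (t * r))) / t powr (1 + \<sigma>)))
    (Gamma (1 - \<sigma>) / \<sigma> * r powr \<sigma>)"
proof (cases "r = 0")
  case True
  then show ?thesis using s by (simp add: has_bochner_integral_zero)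
next
  case False
  then have r': "r > 0" using r by (simp add: less_le)
  have G: "Gamma (1 - \<sigma>) > 0" using s by (intro Gamma_real_pos) auto
  show ?thesis
  proof (rule has_bochner_integral_nn_integral)
    show "0 \<le> Gamma (1 - \<sigma>) / \<sigma> * r powr \<sigma>" using G s by simp
    show "(\<integral>\<^sup>+t. ennreal (indicator {0<..} t * ((1 - exp (- (t * r))) / t powr (1 + \<sigma>))) \<partial>lborel)
      = ennreal (Gamma (1 - \<sigma>) / \<sigma> * r powr \<sigma>)"
      by (rule nn_integral_one_minus_exp[OF r' s])
    show "AE t in lborel. 0 \<le> indicator {0<..} t * ((1 - exp (- (t * r))) / t powr (1 + \<sigma>))"
      using r by (intro AE_I2) (auto split: split_indicator)
  qed auto
qed

lemma abs_Gamma_minus: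
  assumes "0 < \<sigma>" "\<sigma> < 1"
  shows "\<bar>Gamma (- \<sigma>)\<bar> = Gamma (1 - \<sigma>) / (\<sigma>::real)"
proof -
  have "- \<sigma> \<notin> \<int>\<^sub>\<le>\<^sub>0"
  proof
    assume "- \<sigma> \<in> \<int>\<^sub>\<le>\<^sub>0"
    then obtain n where n: "- \<sigma> = of_int n" by (auto elim: nonpos_Ints_cases)
    with assms have "- 1 < real_of_int n" "real_of_int n < 0" by simp_all
    then have "- 1 < n" "n < 0" by linarith+
    then show False by simp
  qed
  then have *: "Gamma (1 - \<sigma>) = - \<sigma> * Gamma (- \<sigma>)"
    using Gamma_plus1[of "- \<sigma>"] by simp
  have "Gamma (1 - \<sigma>) > 0" using assms by (intro Gamma_real_pos) auto
  with * have "\<bar>Gamma (- \<sigma>)\<bar> = - Gamma (- \<sigma>)"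
    using assms by (simp add: mult_less_0_iff)
  then show ?thesis using assms * by (simp add: field_simps)
qed

lemma heat_semigroup_eq:
  "heat_semigroup t (indicator {0}) x = cos_coeff (\<lambda>\<theta>. exp (- t * lap_symbol \<theta>)) x"
proof -
  have "indicator {0} \<in> fin_supp" by (simp add: fin_supp_def indicator_def)
  moreover have "{y. indicator {0} y \<noteq> (0::real)} = {0::int}" by (auto simp: indicator_def)
  ultimately show ?thesis
    by (simp add: heat_semigroup_def lap_calculus_eq continuous_intros multiplier_def)
qed

text \<open>
  For \<open>x \<noteq> 0\<close> the constant 1 has no coefficient at \<open>x\<close>, so the heat kernel may be replaced
  by the coefficient of \<open>exp (- t s) - 1\<close>, with \<open>s\<close> the symbol. This is what makes the integral
  converge absolutely at \<open>t = 0\<close>; integrating in \<open>t\<close> first gives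
  \<open>- \<bar>\<Gamma>(-\<sigma>)\<bar> s\<^sup>\<sigma>\<close>.
\<close>

lemma frac_kernel_eq:
  assumes s: "0 < \<sigma>" "\<sigma> < 1" and x: "x \<noteq> 0"
  shows "frac_kernel \<sigma> x = - power_coeff \<sigma> x"
proof -
  define c where "c = Gamma (1 - \<sigma>) / \<sigma>"
  have c: "c > 0" using s by (auto simp: c_def intro!: divide_pos_pos Gamma_real_pos)
  define C where "C = (\<lambda>\<theta>::real. cos (2 * of_int x * \<theta>))"
  have [measurable]: "C \<in> borel_measurable borel" "lap_symbol \<in> borel_measurable borel"
    unfolding C_def lap_symbol_def[abs_def] by measurable
  define f where "f = (\<lambda>t r. indicator {0<..} t * ((1 - exp (- (t * r))) / t powr (1 + \<sigma>)))"
  define g where "g = (\<lambda>\<theta> t. indicator {0..pi/2} \<theta> * C \<theta> * f t (lap_symbol \<theta>))"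
  have f: "has_bochner_integral lborel (\<lambda>t. f t (lap_symbol \<theta>)) (c * lap_symbol \<theta> powr \<sigma>)" for \<theta>
    unfolding f_def c_def by (intro has_bochner_integral_one_minus_exp lap_symbol_nonneg s)
  have f0: "0 \<le> f t (lap_symbol \<theta>)" for t \<theta>
    using lap_symbol_nonneg[of \<theta>] by (auto simp: f_def split: split_indicator)
  have cs: "continuous_on {0..pi/2} (\<lambda>\<theta>. lap_symbol \<theta> powr \<sigma>)"
    using s by (intro continuous_on_powr' continuous_intros) (auto simp: lap_symbol_nonneg)
  have gint: "integrable (lborel \<Otimes>\<^sub>M lborel) (case_prod g)"
  proof (rule lborel_pair.Fubini_integrable)
    show "case_prod g \<in> borel_measurable (lborel \<Otimes>\<^sub>M lborel)"
      unfolding g_def f_def by measurable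
    have "(\<integral>t. norm (case (\<theta>, t) of (x, xa) \<Rightarrow> g x xa) \<partial>lborel) = indicator {0..pi/2} \<theta> *\<^sub>R (\<bar>C \<theta>\<bar> * (c * lap_symbol \<theta> powr \<sigma>))" for \<theta>
      using has_bochner_integral_integral_eq[OF f[of \<theta>]] f0 
      by (simp add: g_def abs_mult)
    moreover have "integrable lborel (\<lambda>\<theta>. indicator {0..pi/2} \<theta> *\<^sub>R (\<bar>C \<theta>\<bar> * (c * lap_symbol \<theta> powr \<sigma>)))"
      using borel_integrable_atLeastAtMost'[of 0 "pi/2" "\<lambda>\<theta>. \<bar>C \<theta>\<bar> * (c * lap_symbol \<theta> powr \<sigma>)"]
      unfolding set_integrable_def by (simp add: C_def continuous_intros cs)
    ultimately show "integrable lborel (\<lambda>\<theta>. \<integral>t. norm (case (\<theta>, t) of (x, xa) \<Rightarrow> g x xa) \<partial>lborel)"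
      by simp
    show "AE \<theta> in lborel. integrable lborel (\<lambda>t. case (\<theta>, t) of (x, xa) \<Rightarrow> g x xa)"
      using f by (auto simp: g_def has_bochner_integral_iff)
  qed
  have th: "(\<integral>\<theta>. g \<theta> t \<partial>lborel) = - (pi/2) * (indicator {0<..} t *\<^sub>R (heat_semigroup t (indicator {0}) x / t powr (1 + \<sigma>)))" for t
  proof (cases "t > 0")
    case True
    define E where "E = (\<lambda>\<theta>. exp (- t * lap_symbol \<theta>))"
    have E: "continuous_on {0..pi/2} E" unfolding E_def by (intro continuous_intros)
    have "(\<integral>\<theta>. g \<theta> t \<partial>lborel) = (LBINT \<theta>:{0..pi/2}. (1 - E \<theta>) * C \<theta> / t powr (1 + \<sigma>))"
      unfolding set_lebesgue_integral_def
      using True by (intro Bochner_Integration.integral_cong refl) (simp add: g_def f_def E_def)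
    also have "\<dots> = integral {0..pi/2} (\<lambda>\<theta>. (1 - E \<theta>) * C \<theta> / t powr (1 + \<sigma>))"
      by (intro set_borel_integral_eq_integral borel_integrable_atLeastAtMost')
         (use True in \<open>auto simp: C_def intro!: continuous_intros E\<close>)
    also have "\<dots> = integral {0..pi/2} (\<lambda>\<theta>. (1 - E \<theta>) * C \<theta>) / t powr (1 + \<sigma>)"
      by (rule Henstock_Kurzweil_Integration.integral_divide)
    also have "integral {0..pi/2} (\<lambda>\<theta>. (1 - E \<theta>) * C \<theta>) = pi/2 * cos_coeff (\<lambda>\<theta>. 1 - E \<theta>) x"
      by (simp add: cos_coeff_def C_def)
    also have "cos_coeff (\<lambda>\<theta>. 1 - E \<theta>) x = - cos_coeff E x"
      using x by (subst cos_coeff_diff) (auto intro!: continuous_abs_integrable E simp: cos_coeff_one)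
    finally show ?thesis using True by (simp add: heat_semigroup_eq E_def)
  next
    case False
    then show ?thesis by (simp add: g_def f_def)
  qed
  have tt: "(\<integral>t. g \<theta> t \<partial>lborel) = indicator {0..pi/2} \<theta> *\<^sub>R (c * (lap_symbol \<theta> powr \<sigma> * C \<theta>))" for \<theta>
    using has_bochner_integral_integral_eq[OF f[of \<theta>]] by (simp add: g_def)
  have "- (pi/2) * (LBINT t:{0<..}. heat_semigroup t (indicator {0}) x / t powr (1 + \<sigma>))
    = (\<integral>t. (\<integral>\<theta>. g \<theta> t \<partial>lborel) \<partial>lborel)"
    by (simp only: th set_lebesgue_integral_def integral_mult_right_zero)
  also have "\<dots> = (\<integral>\<theta>. (\<integral>t. g \<theta> t \<partial>lborel) \<partial>lborel)"
    by (rule lborel_pair.Fubini_integral[OF gint])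
  also have "\<dots> = (LBINT \<theta>:{0..pi/2}. c * (lap_symbol \<theta> powr \<sigma> * C \<theta>))"
    by (simp only: tt set_lebesgue_integral_def)
  also have "\<dots> = integral {0..pi/2} (\<lambda>\<theta>. c * (lap_symbol \<theta> powr \<sigma> * C \<theta>))"
    by (intro set_borel_integral_eq_integral borel_integrable_atLeastAtMost')
       (auto simp: C_def intro!: continuous_intros cs)
  also have "\<dots> = c * (pi/2 * power_coeff \<sigma> x)"
    by (simp add: power_coeff_def cos_coeff_def C_def)
  finally have "pi/2 * ((LBINT t:{0<..}. heat_semigroup t (indicator {0}) x / t powr (1 + \<sigma>)) + c * power_coeff \<sigma> x) = 0"
    by (simp add: algebra_simps)
  then have "(LBINT t:{0<..}. heat_semigroup t (indicator {0}) x / t powr (1 + \<sigma>)) = - c * power_coeff \<sigma> x"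
    by simp
  then show ?thesis using x c abs_Gamma_minus[OF s, folded c_def]
    by (simp add: frac_kernel_def)
qed

section \<open>Quadratic forms of jump kernels\<close>

text \<open>
  Convolution with \<open>a\<close> is the operator \<open>\<Sum>\<^sub>y \<kappa>(x - y) (f x - f y)\<close> with the even
  kernel \<open>\<kappa> = - a\<close> off 0; the diagonal value \<open>a 0\<close> is the total mass of \<open>\<kappa>\<close>, as
  expressed by \<open>sum_zero\<close>.
\<close>

locale jump_kernel =
  fixes a :: "int \<Rightarrow> real"
  assumes even: "a (- x) = a x"
    and neg: "x \<noteq> 0 \<Longrightarrow> a x < 0"
    and sum_zero: "(a has_sum 0) UNIV"
begin

text \<open>
  The bilinear form of the operator minus the weight \<open>w\<close>, for functions that vanish outside
  \<open>S\<close>. Carrying the set keeps all sums finite; by \<open>form_mono_neutral\<close> the value depends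
  on \<open>f\<close> and \<open>g\<close> only, once \<open>S\<close> contains their supports.
\<close>

definition form :: "(int \<Rightarrow> real) \<Rightarrow> int set \<Rightarrow> (int \<Rightarrow> real) \<Rightarrow> (int \<Rightarrow> real) \<Rightarrow> real"
  where "form w S f g = (\<Sum>x\<in>S. f x * ((\<Sum>y\<in>S. a (x - y) * g y) - w x * g x))"

definition solution :: "(int \<Rightarrow> real) \<Rightarrow> (int \<Rightarrow> real) \<Rightarrow> bool"
  where "solution w u \<longleftrightarrow> (\<forall>x. 0 < u x) \<and> (\<forall>x. ((\<lambda>y. a (x - y) * u y) has_sum w x * u x) UNIV)"

lemma form_mono_neutral:
  assumes "finite T" "S \<subseteq> T" "\<And>x. x \<notin> S \<Longrightarrow> f x = 0" "\<And>x. x \<notin> S \<Longrightarrow> g x = 0"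
  shows "form w T f g = form w S f g"
proof -
  have 1: "(\<Sum>y\<in>T. a (x - y) * g y) = (\<Sum>y\<in>S. a (x - y) * g y)" for x
    using assms by (intro sum.mono_neutral_right) auto
  show ?thesis
    unfolding form_def 1 using assms by (intro sum.mono_neutral_right) auto
qed

lemma even_diff: "a (x - y) = a (y - x)"
  using even[of "x - y"] by simp

lemma form_sym: "form w S f g = form w S g f"
proof -
  have "(\<Sum>x\<in>S. \<Sum>y\<in>S. f x * (a (x - y) * g y)) = (\<Sum>x\<in>S. \<Sum>y\<in>S. g x * (a (x - y) * f y))"
    by (subst sum.swap) (intro sum.cong refl, subst even_diff, simp)
  then show ?thesis
    by (simp add: form_def right_diff_distrib sum_subtractf sum_distrib_left mult_ac)
qed

lemma form_add:
  "form w S (\<lambda>x. f x + g x) (\<lambda>x. f x + g x) = form w S f f + 2 * form w S f g + form w S g g"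
proof -
  have "form w S (\<lambda>x. f x + g x) (\<lambda>x. f x + g x) = form w S f f + form w S f g + form w S g f + form w S g g"
    unfolding form_def
    by (simp add: sum.distrib[symmetric] distrib_left distrib_right)
       (simp add: sum.distrib algebra_simps)
  then show ?thesis using form_sym[of w S f g] by simp
qed

lemma form_scale: "form w S (\<lambda>x. c * f x) (\<lambda>x. c * f x) = c\<^sup>2 * form w S f f"
  unfolding form_def sum_distrib_left
  by (intro sum.cong refl)
     (simp add: power2_eq_square right_diff_distrib sum_distrib_left mult_ac)

lemma form_weight:
  "form w' S f f = form w S f f - (\<Sum>x\<in>S. (w' x - w x) * (f x)\<^sup>2)"
  unfolding form_def
  by (simp add: sum_subtractf[symmetric] power2_eq_square algebra_simps)

text \<open>
  The omitted terms have \<open>y \<noteq> x\<close> and are negative.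
\<close>

lemma kernel_sum_le_finite:
  assumes u: "solution w u" and S: "finite S" "x \<in> S"
  shows "w x * u x \<le> (\<Sum>y\<in>S. a (x - y) * u y)"
proof -
  have hs: "((\<lambda>y. a (x - y) * u y) has_sum w x * u x) UNIV" and pos: "\<And>y. 0 < u y"
    using u by (auto simp: solution_def)
  have hs': "((\<lambda>y. if y \<in> S then a (x - y) * u y else 0) has_sum (\<Sum>y\<in>S. a (x - y) * u y)) UNIV"
    by (rule has_sum_finite_neutralI[of S]) (use S in auto)
  show ?thesis
  proof (rule has_sum_mono[OF hs hs'])
    fix y
    show "a (x - y) * u y \<le> (if y \<in> S then a (x - y) * u y else 0)"
      using S pos[of y] neg[of "x - y"] by (cases "x = y") (auto simp: mult_le_0_iff)
  qed
qed

text \<open>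
  Replacing \<open>w x\<close> by the finite sum of \<open>a (x - y) u y / u x\<close> only decreases the form.
  Symmetrised in \<open>x\<close> and \<open>y\<close>, what remains is one half of the sum of all the nonnegative
  terms \<open>- a (x - y) u x u y (f x / u x - f y / u y)\<^sup>2\<close>, of which two, \<open>(x0, y0)\<close> and
  \<open>(y0, x0)\<close>, are kept.
\<close>

lemma ground_state_inequality:
  assumes u: "solution w u" and S: "finite S" and x0: "x0 \<in> S" "y0 \<in> S" "x0 \<noteq> y0"
  shows "- a (x0 - y0) * u x0 * u y0 * (f x0 / u x0 - f y0 / u y0)\<^sup>2 \<le> form w S f f"
proof -
  have pos: "0 < u x" for x using u by (simp add: solution_def)
  define h where "h = (\<lambda>(x, y). - a (x - y) * u x * u y * (f x / u x - f y / u y)\<^sup>2)"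
  define r where "r = (\<lambda>x y. a (x - y) * (f x * f y - (f x)\<^sup>2 * u y / u x))"
  have h0: "0 \<le> h (x, y)" for x y
  proof (cases "x = y")
    case False
    then have "0 \<le> - a (x - y)" using neg[of "x - y"] by simp
    then show ?thesis
      unfolding h_def prod.case
      using pos[of x] pos[of y] by (intro mult_nonneg_nonneg) auto
  qed (simp add: h_def)
  have hr: "h (x, y) = r x y + r y x" for x y
  proof -
    have "p * q * (s / p - t / q)\<^sup>2 = s\<^sup>2 * q / p + t\<^sup>2 * p / q - 2 * (s * t)" if "p > 0" "q > 0" for p q s t :: real
      using that by (simp add: power2_eq_square field_simps)
    from this[OF pos pos, of x y "f x" "f y"]
    have "h (x, y) = - a (x - y) * ((f x)\<^sup>2 * u y / u x + (f y)\<^sup>2 * u x / u y - 2 * (f x * f y))"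
      by (simp add: h_def mult.assoc)
    then show ?thesis using even_diff[of y x]
      by (simp add: r_def algebra_simps)
  qed
  have "(\<Sum>y\<in>S. r x y) \<le> f x * ((\<Sum>y\<in>S. a (x - y) * f y) - w x * f x)" if x: "x \<in> S" for x
  proof -
    have "(f x)\<^sup>2 / u x * (w x * u x) \<le> (f x)\<^sup>2 / u x * (\<Sum>y\<in>S. a (x - y) * u y)"
      using pos[of x] by (intro mult_left_mono kernel_sum_le_finite[OF u S x]) auto
    moreover have "(f x)\<^sup>2 / u x * (w x * u x) = f x * (w x * f x)"
      using pos[of x] by (simp add: power2_eq_square)
    ultimately show ?thesis
      by (simp add: r_def right_diff_distrib sum_subtractf sum_distrib_left mult_ac)
  qed
  then have le: "(\<Sum>x\<in>S. \<Sum>y\<in>S. r x y) \<le> form w S f f"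
    unfolding form_def by (rule sum_mono)
  have "2 * h (x0, y0) = (\<Sum>p\<in>{(x0, y0), (y0, x0)}. h p)"
    using x0 hr[of x0 y0] hr[of y0 x0] by simp
  also have "\<dots> \<le> (\<Sum>p\<in>S \<times> S. h p)"
    using x0 S h0 by (intro sum_mono2) auto
  also have "\<dots> = (\<Sum>x\<in>S. \<Sum>y\<in>S. r x y + r y x)"
    by (simp add: sum.cartesian_product' hr)
  also have "\<dots> = (\<Sum>x\<in>S. \<Sum>y\<in>S. r x y) + (\<Sum>x\<in>S. \<Sum>y\<in>S. r y x)"
    by (simp add: sum.distrib)
  also have "(\<Sum>x\<in>S. \<Sum>y\<in>S. r y x) = (\<Sum>x\<in>S. \<Sum>y\<in>S. r x y)"
    by (rule sum.swap)
  finally have "h (x0, y0) \<le> form w S f f" using le by simp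
  then show ?thesis by (simp add: h_def)
qed

text \<open>
  The ground state inequality speaks of a pair of points, so two are added to \<open>S\<close>, on which
  \<open>f\<close> is first extended by 0.
\<close>

lemma hardy_of_solution:
  assumes u: "solution w u" and S: "finite S"
  shows "0 \<le> form w S f f"
proof -
  define T where "T = S \<union> {0, 1}"
  define f' where "f' = (\<lambda>x. if x \<in> S then f x else 0)"
  have "- a (0 - 1) * u 0 * u 1 * (f' 0 / u 0 - f' 1 / u 1)\<^sup>2 \<le> form w T f' f'"
    using S by (intro ground_state_inequality[OF u]) (auto simp: T_def)
  moreover have "0 \<le> - a (0 - 1) * u 0 * u 1 * (f' 0 / u 0 - f' 1 / u 1)\<^sup>2"
  proof -
    have "0 \<le> - a (0 - 1)" using neg[of "-1"] by simp
    moreover have "0 \<le> u x" for x using u by (simp add: solution_def less_imp_le)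
    ultimately show ?thesis by (intro mult_nonneg_nonneg) auto
  qed
  moreover have "form w T f' f' = form w S f' f'"
    using S by (intro form_mono_neutral) (auto simp: T_def f'_def)
  moreover have "form w S f' f' = form w S f f"
    by (simp add: form_def f'_def cong: sum.cong)
  ultimately show ?thesis by simp
qed

end

text \<open>
  A positive solution that is so small at infinity that its truncations have bounded form; this is
  what \<open>bound\<close> provides.
\<close>

locale vanishing_solution = jump_kernel +
  fixes w \<psi> :: "int \<Rightarrow> real" and C :: real
  assumes sol: "solution w \<psi>"
    and w_nonneg: "0 \<le> w x"
    and decr: "\<bar>x\<bar> \<le> \<bar>y\<bar> \<Longrightarrow> \<psi> y \<le> \<psi> x"
    and vanish: "(\<lambda>n. \<psi> (int n)) \<longlonglongrightarrow> 0"
    and bound: "\<psi> (int n) * (\<Sum>x\<in>window n. w x * \<psi> x) \<le> C"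
begin

lemma psi_pos: "0 < \<psi> x" using sol by (simp add: solution_def)

definition trunc :: "nat \<Rightarrow> int \<Rightarrow> real"
  where "trunc N x = (if x \<in> window N then \<psi> x - \<psi> (int N) else 0)"

lemma trunc_nonneg: "0 \<le> trunc N x"
  using decr[of x "int N"] by (auto simp: trunc_def)

lemma trunc_ge: "\<psi> x - \<psi> (int N) \<le> trunc N x"
  using decr[of "int N" x] by (auto simp: trunc_def)

lemma trunc_le: "trunc N x \<le> \<psi> x"
  using psi_pos[of "int N"] psi_pos[of x] by (auto simp: trunc_def)

text \<open>
  The function \<open>trunc N\<close> lies above \<open>\<psi> - \<psi>(N)\<close> and agrees with it at \<open>x\<close>. Since
  \<open>a\<close> is negative off 0, its value at \<open>x\<close> only goes down, and the constant
  \<open>\<psi>(N)\<close> is annihilated.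
\<close>

lemma kernel_trunc_le:
  assumes x: "x \<in> window N"
  shows "(\<Sum>y\<in>window N. a (x - y) * trunc N y) \<le> w x * \<psi> x"
proof -
  have 1: "((\<lambda>y. a (x - y) * \<psi> y) has_sum w x * \<psi> x) UNIV"
    using sol by (simp add: solution_def)
  have "((\<lambda>y. a (x - y)) has_sum 0) UNIV"
    using sum_zero by (subst has_sum_reindex_bij_witness[of UNIV "\<lambda>y. x - y" "\<lambda>y. x - y" UNIV a]) auto
  from has_sum_add[OF 1 has_sum_cmult_left[OF this, of "- \<psi> (int N)"]]
  have 2: "((\<lambda>y. a (x - y) * (\<psi> y - \<psi> (int N))) has_sum w x * \<psi> x) UNIV"
    by (simp add: right_diff_distrib)
  have 3: "((\<lambda>y. a (x - y) * trunc N y) has_sum (\<Sum>y\<in>window N. a (x - y) * trunc N y)) UNIV"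
    by (rule has_sum_finite_neutralI[of "window N"]) (auto simp: trunc_def)
  show ?thesis
  proof (rule has_sum_mono[OF 3 2])
    fix y
    show "a (x - y) * trunc N y \<le> a (x - y) * (\<psi> y - \<psi> (int N))"
    proof (cases "y \<in> window N")
      case False
      then have "a (x - y) \<le> 0" using x neg[of "x - y"] by force
      then show ?thesis using trunc_ge by (intro mult_left_mono_neg)
    qed (simp add: trunc_def)
  qed
qed

lemma form_trunc_le:
  assumes f: "\<And>x. 0 \<le> f x" "\<And>x. x \<notin> window M \<Longrightarrow> f x = 0" and MN: "M \<le> N"
  shows "form w (window N) f (trunc N) \<le> \<psi> (int N) * (\<Sum>x\<in>window M. w x * f x)"
proof -
  have "form w (window N) f (trunc N) \<le> (\<Sum>x\<in>window N. f x * (w x * \<psi> (int N)))"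
    unfolding form_def
  proof (intro sum_mono mult_left_mono f)
    fix x assume x: "x \<in> window N"
    have "w x * trunc N x = w x * \<psi> x - w x * \<psi> (int N)" using x by (simp add: trunc_def right_diff_distrib)
    then show "(\<Sum>y\<in>window N. a (x - y) * trunc N y) - w x * trunc N x \<le> w x * \<psi> (int N)"
      using kernel_trunc_le[OF x] by simp
  qed
  also have "\<dots> = (\<Sum>x\<in>window M. f x * (w x * \<psi> (int N)))"
    using MN f(2) by (intro sum.mono_neutral_right) auto
  finally show ?thesis by (simp add: sum_distrib_left mult_ac)
qed

lemma form_trunc: "form w (window N) (trunc N) (trunc N) \<le> C"
proof -
  have "form w (window N) (trunc N) (trunc N) \<le> \<psi> (int N) * (\<Sum>x\<in>window N. w x * trunc N x)"
    by (rule form_trunc_le[OF trunc_nonneg _ order_refl]) (simp only: trunc_def if_False)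
  also have "\<dots> \<le> \<psi> (int N) * (\<Sum>x\<in>window N. w x * \<psi> x)"
    by (intro mult_left_mono sum_mono trunc_le w_nonneg less_imp_le psi_pos)
  finally show ?thesis using bound[of N] by simp
qed

lemma psi_small:
  assumes "e > 0" obtains N where "N \<ge> M" "\<psi> (int N) < e"
proof -
  have "eventually (\<lambda>n. \<psi> (int n) < e) sequentially"
    using order_tendstoD(2)[OF vanish assms] .
  then obtain N0 where "\<And>n. n \<ge> N0 \<Longrightarrow> \<psi> (int n) < e" by (auto simp: eventually_sequentially)
  then show ?thesis using that[of "max M N0"] by simp
qed

text \<open>
  \<open>e\<close> is a sum of \<open>K\<close> truncations. In the step the level \<open>N\<close> is taken so large that the
  mixed form of the new truncation with the old sum is at most 1; the form then grows linearly in
  \<open>K\<close>, whereas that of \<open>K \<psi>\<^sub>N\<close> for a single level would be bounded only by \<open>K\<^sup>2 C\<close>.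
  All levels satisfy \<open>\<psi>(N) < \<delta>\<close>, so the averages stay close to \<open>\<psi>\<close>.
\<close>

lemma sparse_averages:
  assumes "\<delta> > 0"
  shows "\<exists>e M. (\<forall>x. x \<notin> window M \<longrightarrow> e x = 0) \<and> (\<forall>x. 0 \<le> e x) \<and>
    (\<forall>x. real K * (\<psi> x - \<delta>) \<le> e x \<and> e x \<le> real K * \<psi> x) \<and> form w (window M) e e \<le> real K * (C + 2)"
proof (induction K)
  case 0
  show ?case by (rule exI[of _ "\<lambda>x. 0"]) (simp add: form_def)
next
  case (Suc K)
  then obtain e M where e: "\<And>x. x \<notin> window M \<Longrightarrow> e x = 0" "\<And>x. 0 \<le> e x"
    "\<And>x. real K * (\<psi> x - \<delta>) \<le> e x" "\<And>x. e x \<le> real K * \<psi> x" "form w (window M) e e \<le> real K * (C + 2)"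
    by blast
  define D where "D = (\<Sum>x\<in>window M. w x * e x)"
  have D: "D \<ge> 0" unfolding D_def by (intro sum_nonneg mult_nonneg_nonneg w_nonneg e)
  \<comment> \<open>the mixed form with \<open>e\<close> is at most \<open>\<psi>(N) D\<close>\<close>
  obtain N where N: "N \<ge> M" "\<psi> (int N) < min \<delta> (1 / (D + 1))"
    using psi_small[of "min \<delta> (1 / (D + 1))" M] D assms by auto
  have "\<psi> (int N) * D \<le> 1 / (D + 1) * D" using N D by (intro mult_right_mono) auto
  also have "\<dots> \<le> 1" using D by simp
  finally have cross: "form w (window N) e (trunc N) \<le> 1"
    using form_trunc_le[of e M N] e N unfolding D_def by force
  have "form w (window N) e e = form w (window M) e e"
    using N e by (intro form_mono_neutral) auto
  then have "form w (window N) (\<lambda>x. e x + trunc N x) (\<lambda>x. e x + trunc N x) \<le> real (Suc K) * (C + 2)"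
    unfolding form_add using cross e(5) form_trunc[of N] by (simp add: algebra_simps)
  moreover have "e x + trunc N x = 0" if "x \<notin> window N" for x
    using that N e(1)[of x] by (force simp: trunc_def)
  moreover have "real (Suc K) * (\<psi> x - \<delta>) \<le> e x + trunc N x" for x
    using e(3)[of x] trunc_ge[of x N] N by (simp add: algebra_simps)
  moreover have "e x + trunc N x \<le> real (Suc K) * \<psi> x" for x
    using e(4)[of x] trunc_le[of N x] by (simp add: algebra_simps)
  moreover have "0 \<le> e x + trunc N x" for x using e(2) trunc_nonneg by simp
  ultimately show ?case
    by (intro exI[of _ "\<lambda>x. e x + trunc N x"] exI[of _ N] conjI allI impI)
qed

text \<open>
  The averages \<open>e / K\<close> with \<open>\<delta> = 1 / K\<close> have form at most \<open>(C + 2) / K\<close>.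
\<close>

lemma null_sequence:
  obtains \<Phi> :: "nat \<Rightarrow> int \<Rightarrow> real" and M :: "nat \<Rightarrow> nat"
  where "\<And>n x. x \<notin> window (M n) \<Longrightarrow> \<Phi> n x = 0"
    and "(\<lambda>n. form w (window (M n)) (\<Phi> n) (\<Phi> n)) \<longlonglongrightarrow> 0"
    and "\<And>x. (\<lambda>n. \<Phi> n x) \<longlonglongrightarrow> \<psi> x"
proof -
  have "\<exists>p. (\<forall>x. x \<notin> window (snd p) \<longrightarrow> fst p x = 0) \<and>
    (\<forall>x. real (Suc n) * (\<psi> x - 1 / Suc n) \<le> fst p x \<and> fst p x \<le> real (Suc n) * \<psi> x) \<and>
    form w (window (snd p)) (fst p) (fst p) \<le> real (Suc n) * (C + 2)" for n :: nat
    using sparse_averages[of "1 / Suc n" "Suc n"] by auto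
  then obtain p :: "nat \<Rightarrow> (int \<Rightarrow> real) \<times> nat" where
    p1: "\<And>n x. x \<notin> window (snd (p n)) \<Longrightarrow> fst (p n) x = 0" and
    p2: "\<And>n x. real (Suc n) * (\<psi> x - 1 / Suc n) \<le> fst (p n) x" and
    p3: "\<And>n x. fst (p n) x \<le> real (Suc n) * \<psi> x" and
    p4: "\<And>n. form w (window (snd (p n))) (fst (p n)) (fst (p n)) \<le> real (Suc n) * (C + 2)"
    by metis
  define \<Phi> where "\<Phi> = (\<lambda>n x. 1 / real (Suc n) * fst (p n) x)"
  show ?thesis
  proof (rule that[of "\<lambda>n. snd (p n)" \<Phi>])
    show "\<Phi> n x = 0" if "x \<notin> window (snd (p n))" for n x using p1[OF that] by (simp add: \<Phi>_def)
    show "(\<lambda>n. form w (window (snd (p n))) (\<Phi> n) (\<Phi> n)) \<longlonglongrightarrow> 0"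
    proof (rule tendsto_sandwich[OF _ _ tendsto_const])
      show "eventually (\<lambda>n. 0 \<le> form w (window (snd (p n))) (\<Phi> n) (\<Phi> n)) sequentially"
        by (intro always_eventually allI hardy_of_solution[OF sol]) simp
      have "form w (window (snd (p n))) (\<Phi> n) (\<Phi> n) \<le> (C + 2) * (1 / real (Suc n))" for n
      proof -
        have "form w (window (snd (p n))) (\<Phi> n) (\<Phi> n) \<le> (1 / real (Suc n))\<^sup>2 * (real (Suc n) * (C + 2))"
          unfolding \<Phi>_def form_scale by (intro mult_left_mono p4) simp
        also have "\<dots> = (C + 2) * (1 / real (Suc n))"
          by (simp add: power2_eq_square del: of_nat_Suc)
        finally show ?thesis .
      qed
      then show "eventually (\<lambda>n. form w (window (snd (p n))) (\<Phi> n) (\<Phi> n) \<le> (C + 2) * (1 / real (Suc n))) sequentially"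
        by simp
      show "(\<lambda>n. (C + 2) * (1 / real (Suc n))) \<longlonglongrightarrow> 0"
        by (intro tendsto_mult_right_zero LIMSEQ_Suc lim_1_over_n)
    qed
    show "(\<lambda>n. \<Phi> n x) \<longlonglongrightarrow> \<psi> x" for x
    proof (rule tendsto_sandwich[OF _ _ _ tendsto_const])
      have "\<psi> x - 1 / real (Suc n) \<le> \<Phi> n x" for n
        using p2[of n x] by (simp add: \<Phi>_def field_simps del: of_nat_Suc)
      then show "eventually (\<lambda>n. \<psi> x - 1 / real (Suc n) \<le> \<Phi> n x) sequentially" by simp
      have "\<Phi> n x \<le> \<psi> x" for n
        using p3[of n x] by (simp add: \<Phi>_def field_simps del: of_nat_Suc)
      then show "eventually (\<lambda>n. \<Phi> n x \<le> \<psi> x) sequentially" by simp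
      show "(\<lambda>n. \<psi> x - 1 / real (Suc n)) \<longlonglongrightarrow> \<psi> x"
        using tendsto_diff[OF tendsto_const LIMSEQ_Suc[OF lim_1_over_n], of "\<psi> x"] by simp
    qed
  qed
qed

text \<open>
  Along the null sequence \<open>(w' x - w x) \<psi>(x)\<^sup>2\<close> is a limit of quantities bounded by the form.
\<close>

lemma weight_maximal:
  assumes ge: "\<And>x. w x \<le> w' x"
    and hardy_w_opt: "\<And>S f. finite S \<Longrightarrow> 0 \<le> form w' S f f"
  shows "w' = w"
proof
  fix x0
  obtain \<Phi> M where supp: "\<And>n x. x \<notin> window (M n) \<Longrightarrow> \<Phi> n x = 0"
    and lim: "(\<lambda>n. form w (window (M n)) (\<Phi> n) (\<Phi> n)) \<longlonglongrightarrow> 0"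
    and conv: "\<And>x. (\<lambda>n. \<Phi> n x) \<longlonglongrightarrow> \<psi> x"
    by (rule null_sequence) blast
  have "(w' x0 - w x0) * (\<Phi> n x0)\<^sup>2 \<le> form w (window (M n)) (\<Phi> n) (\<Phi> n)" for n
  proof -
    have "(w' x0 - w x0) * (\<Phi> n x0)\<^sup>2 \<le> (\<Sum>x\<in>window (M n). (w' x - w x) * (\<Phi> n x)\<^sup>2)"
    proof (cases "x0 \<in> window (M n)")
      case True
      then show ?thesis using ge by (intro member_le_sum[of x0 _ "\<lambda>x. (w' x - w x) * (\<Phi> n x)\<^sup>2"]) auto
    next
      case False
      then show ?thesis using ge supp[OF False] by (simp add: sum_nonneg)
    qed
    also have "\<dots> \<le> form w (window (M n)) (\<Phi> n) (\<Phi> n)"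
      using hardy_w_opt[of "window (M n)" "\<Phi> n"] form_weight[of w' "window (M n)" "\<Phi> n" w] by simp
    finally show ?thesis .
  qed
  moreover have "(\<lambda>n. (w' x0 - w x0) * (\<Phi> n x0)\<^sup>2) \<longlonglongrightarrow> (w' x0 - w x0) * (\<psi> x0)\<^sup>2"
    by (intro tendsto_intros conv)
  ultimately have "(w' x0 - w x0) * (\<psi> x0)\<^sup>2 \<le> 0"
    using lim by (intro LIMSEQ_le[of _ _ _ 0]) auto
  then have "w' x0 - w x0 \<le> 0" using psi_pos[of x0] by (simp add: mult_le_0_iff power2_eq_square)
  then show "w' x0 = w x0" using ge[of x0] by simp
qed

text \<open>
  The form bounds \<open>(\<Phi> n x / u x - \<Phi> n 0 / u 0)\<^sup>2\<close> up to a positive constant, for every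
  positive solution \<open>u\<close>. In the limit \<open>\<psi> / u\<close> takes the same value at \<open>x\<close> and at 0.
\<close>

lemma solution_unique:
  assumes u: "solution w u"
  shows "u x = u 0 / \<psi> 0 * \<psi> x"
proof (cases "x = 0")
  case True
  then show ?thesis using psi_pos[of 0] by simp
next
  case False
  have pos: "0 < u y" for y using u by (simp add: solution_def)
  obtain \<Phi> M where supp: "\<And>n x. x \<notin> window (M n) \<Longrightarrow> \<Phi> n x = 0"
    and lim: "(\<lambda>n. form w (window (M n)) (\<Phi> n) (\<Phi> n)) \<longlonglongrightarrow> 0"
    and conv: "\<And>x. (\<lambda>n. \<Phi> n x) \<longlonglongrightarrow> \<psi> x"
    by (rule null_sequence) blast
  define k where "k = - a (x - 0) * u x * u 0"
  have k: "k > 0" using neg[of x] False pos by (simp add: k_def mult_neg_pos)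
  have "k * (\<Phi> n x / u x - \<Phi> n 0 / u 0)\<^sup>2 \<le> form w (window (M n)) (\<Phi> n) (\<Phi> n)" for n
  proof -
    have "k * (\<Phi> n x / u x - \<Phi> n 0 / u 0)\<^sup>2 \<le> form w (insert x (insert 0 (window (M n)))) (\<Phi> n) (\<Phi> n)"
      unfolding k_def using False by (intro ground_state_inequality[OF u]) auto
    also have "\<dots> = form w (window (M n)) (\<Phi> n) (\<Phi> n)"
      using supp by (intro form_mono_neutral) auto
    finally show ?thesis .
  qed
  moreover have "(\<lambda>n. k * (\<Phi> n x / u x - \<Phi> n 0 / u 0)\<^sup>2) \<longlonglongrightarrow> k * (\<psi> x / u x - \<psi> 0 / u 0)\<^sup>2"
    using pos[of x] pos[of 0] by (intro tendsto_intros conv) auto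
  ultimately have "k * (\<psi> x / u x - \<psi> 0 / u 0)\<^sup>2 \<le> 0"
    using lim by (intro LIMSEQ_le[of _ _ _ 0]) auto
  then have "\<psi> x / u x = \<psi> 0 / u 0" using k by (simp add: mult_le_0_iff)
  then show ?thesis using pos[of x] pos[of 0] psi_pos[of 0] by (simp add: field_simps)
qed

end

section \<open>The kernel and the ground state\<close>

locale fractional_order =
  fixes \<sigma> :: real
  assumes sigma_pos: "0 < \<sigma>" and sigma_less_half: "\<sigma> < 1/2"
begin

text \<open>
  The exponents satisfy \<open>\<sigma> - \<alpha> = - \<gamma>\<close>, so the fractional Laplacian maps
  \<open>power_coeff (- \<alpha>)\<close> to \<open>power_coeff (- \<gamma>)\<close>. They are placed symmetrically,
  \<open>\<alpha> + \<gamma> = 1/2\<close>: then \<open>\<psi>\<^sup>2 w\<close> decays exactly like \<open>1/n\<close>.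
\<close>

definition "\<alpha> = (1 + 2 * \<sigma>) / 4"
definition "\<gamma> = (1 - 2 * \<sigma>) / 4"

abbreviation "a \<equiv> power_coeff \<sigma>"
abbreviation "\<psi> \<equiv> power_coeff (- \<alpha>)"
abbreviation "g \<equiv> power_coeff (- \<gamma>)"

lemma alpha_bounds: "- 1/2 < - \<alpha>" "- \<alpha> < 0" using sigma_pos sigma_less_half by (auto simp: \<alpha>_def)
lemma gamma_bounds: "- 1/2 < - \<gamma>" "- \<gamma> < 0" "0 < \<gamma>" "\<gamma> < 1/4" using sigma_pos sigma_less_half by (auto simp: \<gamma>_def)

lemma a_Suc: "a (int (Suc n)) = (real n - \<sigma>) / (real n + 1 + \<sigma>) * a (int n)"
  using sigma_pos by (intro power_coeff_Suc) auto

lemma a_neg: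
  assumes "x \<noteq> 0" shows "a x < 0"
proof -
  have "a (int (Suc n)) < 0" for n
  proof (induction n)
    case 0
    have "0 < a 0" using sigma_pos by (intro power_coeff_0_pos) auto
    then show ?case unfolding a_Suc using sigma_pos by (simp add: mult_less_0_iff divide_less_0_iff)
  next
    case (Suc n)
    have "0 < (real (Suc n) - \<sigma>) / (real (Suc n) + 1 + \<sigma>)" using sigma_pos sigma_less_half by (intro divide_pos_pos) auto
    then show ?case unfolding a_Suc[of "Suc n"] using Suc by (rule mult_pos_neg)
  qed
  from this[of "nat \<bar>x\<bar> - 1"] show ?thesis using assms by (subst power_coeff_abs) (simp add: Suc_nat_eq_nat_zadd1)
qed

definition "decay_weight x = (1 + \<bar>real_of_int x\<bar>) powr (- 1 - 2 * \<sigma>)"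

lemma decay_weight_pos: "0 < decay_weight x" by (simp add: decay_weight_def)

lemma decay_weight_summable: "decay_weight summable_on UNIV"
proof (rule summable_on_int_even)
  have "summable (\<lambda>n. real n powr (- 1 - 2 * \<sigma>))"
    using sigma_pos by (simp add: summable_real_powr_iff)
  then have "summable (\<lambda>n. real (Suc n) powr (- 1 - 2 * \<sigma>))"
    by (subst summable_Suc_iff)
  then show "summable (\<lambda>n. decay_weight (int n))" by (simp add: decay_weight_def add.commute)
qed (auto simp: decay_weight_def)

text \<open>
  With \<open>c = 2 + \<sigma>\<close> the recurrence, started at 1, is exactly of the form treated in
  \<open>powr_decay\<close>.
\<close>

lemma a_bound: "\<exists>K\<ge>0. \<forall>x. \<bar>a x\<bar> \<le> K * decay_weight x"
proof -
  define f where "f = (\<lambda>n. - a (int (Suc n)))"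
  define q where "q = 1 + 2 * \<sigma>"
  have f: "f n \<le> f 0 * ((2 + \<sigma>) / (real n + (2 + \<sigma>))) powr q" for n
  proof (rule powr_decay)
    show "0 \<le> f n" for n using a_neg[of "int (Suc n)"] by (simp add: f_def)
    show "f (Suc n) \<le> (1 - q / (real n + (2 + \<sigma>))) * f n" for n
    proof -
      have "(real (Suc n) - \<sigma>) / (real (Suc n) + 1 + \<sigma>) = 1 - q / (real n + (2 + \<sigma>))"
        using sigma_pos by (simp add: q_def field_simps)
      then show ?thesis unfolding f_def a_Suc[of "Suc n"] by simp
    qed
  qed (use sigma_pos in \<open>auto simp: q_def\<close>)
  define K where "K = \<bar>a 0\<bar> + f 0 * (2 + \<sigma>) powr q"
  have f0: "0 \<le> f 0" using a_neg[of 1] by (simp add: f_def)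
  have "\<bar>a (int n)\<bar> \<le> K * decay_weight (int n)" for n
  proof (cases n)
    case 0
    then show ?thesis using f0 by (simp add: K_def decay_weight_def)
  next
    case (Suc m)
    have "\<bar>a (int n)\<bar> = f m" using a_neg[of "int n"] Suc by (simp add: f_def)
    also have "\<dots> \<le> f 0 * ((2 + \<sigma>) / (real m + (2 + \<sigma>))) powr q" by (rule f)
    also have "\<dots> \<le> f 0 * ((2 + \<sigma>) / (1 + real n)) powr q"
      using f0 sigma_pos Suc by (intro mult_left_mono powr_mono2 divide_left_mono) (auto simp: q_def)
    also have "\<dots> = f 0 * (2 + \<sigma>) powr q * decay_weight (int n)"
    proof -
      have "decay_weight (int n) = 1 / (1 + real n) powr q"
        using powr_minus_divide[of "1 + real n" q] by (simp add: decay_weight_def q_def)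
      then show ?thesis using sigma_pos by (simp add: powr_divide)
    qed
    also have "\<dots> \<le> K * decay_weight (int n)"
      using decay_weight_pos[of "int n"] by (intro mult_right_mono) (auto simp: K_def)
    finally show ?thesis .
  qed
  from this[of "nat \<bar>x\<bar>" for x] have "\<bar>a x\<bar> \<le> K * decay_weight (int (nat \<bar>x\<bar>))" for x
    by (simp only: power_coeff_abs[symmetric])
  then have "\<bar>a x\<bar> \<le> K * decay_weight x" for x by (simp add: decay_weight_def)
  moreover have "K \<ge> 0" using f0 by (simp add: K_def)
  ultimately show ?thesis by blast
qed

lemma a_abs_summable: "(\<lambda>x. \<bar>a x\<bar>) summable_on UNIV"
proof -
  obtain K where K: "K \<ge> 0" "\<And>x. \<bar>a x\<bar> \<le> K * decay_weight x" using a_bound by blast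
  have "(\<lambda>x. K * decay_weight x) summable_on UNIV" by (intro summable_on_cmult_right decay_weight_summable)
  then show ?thesis by (rule summable_on_comparison_test) (use K in auto)
qed

lemma continuous_lap_symbol_powr: "continuous_on A (\<lambda>t. lap_symbol t powr \<sigma>)"
  using sigma_pos by (intro continuous_on_powr' continuous_intros) (auto simp: lap_symbol_nonneg)

lemma a_eq: "cos_coeff (\<lambda>t. lap_symbol t powr \<sigma>) = a" by (simp add: power_coeff_def)

text \<open>
  This is Fourier inversion at \<open>t = 0\<close>, where the symbol vanishes.
\<close>

lemma a_sum_zero: "(a has_sum 0) UNIV"
proof -
  have "lap_symbol 0 = 0" by (simp add: lap_symbol_def)
  then show ?thesis
    using fourier_inversion[OF continuous_lap_symbol_powr, of 0] a_abs_summable by (simp add: a_eq)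
qed

sublocale jump_kernel a
  by unfold_locales (auto simp: power_coeff_minus a_neg a_sum_zero)

lemma a_psi: "((\<lambda>y. a (x - y) * \<psi> y) has_sum g x) UNIV"
proof -
  have "((\<lambda>z. a z * \<psi> (x - z)) has_sum cos_coeff (\<lambda>t. lap_symbol t powr \<sigma> * lap_symbol t powr (- \<alpha>)) x) UNIV"
    using cos_coeff_mult[OF continuous_lap_symbol_powr, of "\<lambda>t. lap_symbol t powr (- \<alpha>)" x] a_abs_summable
      lap_symbol_powr_integrable[OF alpha_bounds(1)]
    unfolding a_eq power_coeff_def[of "- \<alpha>"] by blast
  also have "cos_coeff (\<lambda>t. lap_symbol t powr \<sigma> * lap_symbol t powr (- \<alpha>)) x = g x"
  proof -
    have "\<sigma> + - \<alpha> = - \<gamma>" by (simp add: \<alpha>_def \<gamma>_def field_simps)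
    then show ?thesis unfolding powr_add[symmetric] power_coeff_def by simp
  qed
  finally show ?thesis
    by (subst has_sum_reindex_bij_witness[of UNIV "\<lambda>y. x - y" "\<lambda>y. x - y" UNIV "\<lambda>z. a z * \<psi> (x - z)"]) auto
qed

lemma w_opt_eq: "w_opt \<sigma> x = g x / \<psi> x"
proof -
  define n where "n = \<bar>real_of_int x\<bar>"
  have e: "- \<gamma> + 1/2 = \<alpha>" "- \<alpha> + 1/2 = \<gamma>" "n - (- \<gamma>) = n + (1 - 2 * \<sigma>) / 4" "n + 1 + - \<gamma> = n + (3 + 2 * \<sigma>) / 4"
    "n - (- \<alpha>) = n + (1 + 2 * \<sigma>) / 4" "n + 1 + - \<alpha> = n + (3 - 2 * \<sigma>) / 4" "- (- \<gamma>) = \<gamma>" "- (- \<alpha>) = \<alpha>"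
    by (simp_all add: \<alpha>_def \<gamma>_def field_simps)
  have p4: "4 powr (- \<gamma>) / 4 powr (- \<alpha>) = 4 powr \<sigma>"
    by (simp add: powr_diff[symmetric] \<alpha>_def \<gamma>_def field_simps)
  have pos: "Gamma \<alpha> > 0" "Gamma \<gamma> > 0" using alpha_bounds gamma_bounds by (auto intro!: Gamma_real_pos)
  have "g x / \<psi> x = (4 powr (- \<gamma>) / 4 powr (- \<alpha>)) * ((Gamma \<alpha>)\<^sup>2 / (Gamma \<gamma>)\<^sup>2) *
    ((Gamma (n + (1 - 2 * \<sigma>) / 4) * Gamma (n + (3 - 2 * \<sigma>) / 4)) /
     (Gamma (n + (3 + 2 * \<sigma>) / 4) * Gamma (n + (1 + 2 * \<sigma>) / 4)))"
    unfolding power_coeff_Gamma[OF gamma_bounds(1,2)] power_coeff_Gamma[OF alpha_bounds] n_def[symmetric] e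
    using pos by (simp add: power2_eq_square mult_ac)
  then show ?thesis unfolding p4 by (simp add: w_opt_def n_def \<alpha>_def \<gamma>_def)
qed

lemma g_pos: "0 < g x" by (rule power_coeff_pos[OF gamma_bounds(1,2)])
lemma psi_positive: "0 < \<psi> x" by (rule power_coeff_pos[OF alpha_bounds])

lemma w_pos: "0 < w_opt \<sigma> x"
  unfolding w_opt_eq by (intro divide_pos_pos g_pos psi_positive)

lemma w_psi: "w_opt \<sigma> x * \<psi> x = g x"
  unfolding w_opt_eq using psi_positive[of x] by simp

section \<open>The size of the ground state\<close>

text \<open>
  The value of \<open>\<psi>\<^sup>2 w\<close> at \<open>n\<close>.
\<close>

definition "mass n = g (int n) * \<psi> (int n)"

lemma mass_pos: "0 < mass n" unfolding mass_def by (intro mult_pos_pos g_pos psi_positive)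

text \<open>
  By the choice of \<open>\<alpha>\<close> and \<open>\<gamma>\<close> the four linear factors of the two recurrences pair up
  to differences of squares.
\<close>

lemma mass_Suc: "mass (Suc n) = ((real n + 1/4)\<^sup>2 - \<sigma>\<^sup>2/4) / ((real n + 3/4)\<^sup>2 - \<sigma>\<^sup>2/4) * mass n"
proof -
  have "(real n - (- \<gamma>)) * (real n - (- \<alpha>)) = (real n + 1/4)\<^sup>2 - \<sigma>\<^sup>2/4"
    "(real n + 1 + - \<gamma>) * (real n + 1 + - \<alpha>) = (real n + 3/4)\<^sup>2 - \<sigma>\<^sup>2/4"
    by (simp_all add: \<alpha>_def \<gamma>_def power2_eq_square field_simps)
  moreover have "A / B * X * (C / D * Y) = (A * C) / (B * D) * (X * Y)" for A B C D X Y :: real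
    by simp
  ultimately show ?thesis
    unfolding mass_def power_coeff_Suc[OF gamma_bounds(1)] power_coeff_Suc[OF alpha_bounds(1)] by (simp only:)
qed

lemma sigma_sq: "0 < \<sigma>\<^sup>2/4" "\<sigma>\<^sup>2/4 < 1/16"
  using sigma_pos sigma_less_half power_strict_mono[of \<sigma> "1/2" 2] by (auto simp: power2_eq_square)

lemma mass_den: "0 < (real n + 3/4)\<^sup>2 - \<sigma>\<^sup>2/4"
proof -
  have "(3/4)\<^sup>2 \<le> (real n + 3/4)\<^sup>2" by (intro power_mono) auto
  then show ?thesis using sigma_sq by (simp add: power2_eq_square)
qed

lemma mass_upper: "(real n + 2) * mass n \<le> 2 * mass 0"
proof (induction n)
  case (Suc n)
  define s where "s = \<sigma>\<^sup>2/4"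
  have s: "0 < s" "s < 1/16" using sigma_sq by (simp_all add: s_def)
  have "(real n + 2) * ((real n + 3/4)\<^sup>2 - s) - (real n + 3) * ((real n + 1/4)\<^sup>2 - s) = 2 * real n + 15/16 + s"
    by (simp add: power2_eq_square field_simps)
  then have "(real n + 3) * ((real n + 1/4)\<^sup>2 - s) \<le> (real n + 2) * ((real n + 3/4)\<^sup>2 - s)"
    using s by linarith
  then have "(real n + 3) * (((real n + 1/4)\<^sup>2 - s) / ((real n + 3/4)\<^sup>2 - s)) \<le> real n + 2"
    using mass_den[of n] by (simp add: s_def[symmetric] field_simps)
  then have "(real n + 3) * (((real n + 1/4)\<^sup>2 - s) / ((real n + 3/4)\<^sup>2 - s)) * mass n \<le> (real n + 2) * mass n"
    using mass_pos[of n] by (intro mult_right_mono) auto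
  then show ?case using Suc unfolding mass_Suc s_def[symmetric] by (simp add: mult.assoc add.commute)
qed simp

lemma mass_lower: "mass 1 \<le> real (Suc n) * mass (Suc n)"
proof (induction n)
  case (Suc n)
  define s where "s = \<sigma>\<^sup>2/4"
  define m where "m = real (Suc n)"
  have s: "0 < s" "s < 1/16" using sigma_sq by (simp_all add: s_def)
  have "(m + 1) * ((m + 1/4)\<^sup>2 - s) - m * ((m + 3/4)\<^sup>2 - s) = 1/16 - s"
    by (simp add: power2_eq_square field_simps)
  then have "m * ((m + 3/4)\<^sup>2 - s) \<le> (m + 1) * ((m + 1/4)\<^sup>2 - s)"
    using s by linarith
  then have "m \<le> (m + 1) * (((m + 1/4)\<^sup>2 - s) / ((m + 3/4)\<^sup>2 - s))"
    unfolding times_divide_eq_right using mass_den[of "Suc n"]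
    by (subst pos_le_divide_eq) (simp_all only: m_def s_def)
  then have "m * mass (Suc n) \<le> (m + 1) * (((m + 1/4)\<^sup>2 - s) / ((m + 3/4)\<^sup>2 - s)) * mass (Suc n)"
    using mass_pos[of "Suc n"] by (intro mult_right_mono) auto
  then show ?case using Suc unfolding mass_Suc[of "Suc n"] s_def[symmetric] m_def[symmetric]
    by (simp add: mult.assoc m_def)
qed simp

text \<open>
  The recurrence for \<open>g\<close> says that \<open>(x + 1 - \<gamma>) g(x + 1) - (x - \<gamma>) g(x) = 2 \<gamma> g(x)\<close>,
  so the sum telescopes.
\<close>

lemma g_sum: "(\<Sum>x\<in>window n. g x) = (real n + \<gamma>) * g (int n) / \<gamma>"
proof (induction n)
  case 0
  then show ?case using gamma_bounds by simp
next
  case (Suc n)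
  have "window (Suc n) = insert (int (Suc n)) (insert (- int (Suc n)) (window n))" by auto
  then have "(\<Sum>x\<in>window (Suc n). g x) = g (int (Suc n)) + (g (- int (Suc n)) + (\<Sum>x\<in>window n. g x))"
    by (simp del: of_nat_Suc)
  also have "\<dots> = 2 * g (int (Suc n)) + (real n + \<gamma>) * g (int n) / \<gamma>"
    unfolding power_coeff_minus Suc by simp
  also have "(real n + \<gamma>) * g (int n) = (real n + 1 - \<gamma>) * g (int (Suc n))"
    using power_coeff_rec[OF gamma_bounds(1), of "int n"] by (simp add: add.commute)
  finally show ?case using gamma_bounds by (simp add: field_simps)
qed

sublocale vanishing_solution a "w_opt \<sigma>" \<psi> "2 * mass 0 / \<gamma>"
proof unfold_locales
  show "solution (w_opt \<sigma>) \<psi>" unfolding solution_def w_psi using psi_positive a_psi by blast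
  show "0 \<le> w_opt \<sigma> x" for x using w_pos[of x] by simp
  show "\<psi> y \<le> \<psi> x" if "\<bar>x\<bar> \<le> \<bar>y\<bar>" for x y by (rule power_coeff_decr[OF alpha_bounds that])
  show "(\<lambda>n. \<psi> (int n)) \<longlonglongrightarrow> 0" by (rule power_coeff_vanish[OF alpha_bounds])
  show "\<psi> (int n) * (\<Sum>x\<in>window n. w_opt \<sigma> x * \<psi> x) \<le> 2 * mass 0 / \<gamma>" for n
  proof -
    have "\<psi> (int n) * (\<Sum>x\<in>window n. w_opt \<sigma> x * \<psi> x) = (real n + \<gamma>) * mass n / \<gamma>"
      unfolding w_psi g_sum by (simp add: mass_def)
    also have "\<dots> \<le> (real n + 2) * mass n / \<gamma>"
      using gamma_bounds mass_pos[of n] by (intro divide_right_mono mult_right_mono) auto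
    also have "\<dots> \<le> 2 * mass 0 / \<gamma>" using gamma_bounds by (intro divide_right_mono mass_upper) auto
    finally show ?thesis .
  qed
qed

section \<open>Optimality\<close>

lemma inner_finite:
  assumes "finite S" "\<And>x. x \<notin> S \<Longrightarrow> f x = 0"
  shows "ell2_inner h f = (\<Sum>x\<in>S. h x * f x)"
  unfolding ell2_inner_def
  by (rule infsumI, rule has_sum_finite_neutralI[of S]) (use assms in auto)

lemma frac_lap_form:
  assumes "f \<in> fin_supp"
  shows "ell2_inner (frac_lap \<sigma> f) f - ell2_inner (\<lambda>x. w x * f x) f = form w {x. f x \<noteq> 0} f f"
proof -
  have fin: "finite {x. f x \<noteq> 0}" using assms by (simp add: fin_supp_def)
  have "continuous_on {0..4} (\<lambda>s::real. s powr \<sigma>)"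
    using sigma_pos by (intro continuous_on_powr' continuous_intros) auto
  then have L: "frac_lap \<sigma> f x = (\<Sum>y | f y \<noteq> 0. a (x - y) * f y)" for x
    using assms by (simp add: frac_lap_def lap_calculus_eq multiplier_def a_eq)
  show ?thesis
    by (subst (1 2) inner_finite[OF fin]) (simp_all add: form_def L sum_subtractf[symmetric] algebra_simps)
qed

text \<open>
  The functional calculus and the inner products on finitely supported functions reduce to finite
  sums, so Hardy weights are described by the forms alone.
\<close>

lemma hardy_weight_iff:
  "hardy_weight \<sigma> w \<longleftrightarrow> (\<forall>x. 0 \<le> w x) \<and> (\<exists>x. w x \<noteq> 0) \<and> (\<forall>S f. finite S \<longrightarrow> 0 \<le> form w S f f)"
proof -
  have "(\<forall>f\<in>fin_supp. ell2_inner (frac_lap \<sigma> f) f \<ge> ell2_inner (\<lambda>x. w x * f x) f)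
    \<longleftrightarrow> (\<forall>S f. finite S \<longrightarrow> 0 \<le> form w S f f)"
  proof (intro iffI ballI allI impI)
    fix S :: "int set" and f :: "int \<Rightarrow> real"
    assume H: "\<forall>f\<in>fin_supp. ell2_inner (frac_lap \<sigma> f) f \<ge> ell2_inner (\<lambda>x. w x * f x) f" and S: "finite S"
    define f' where "f' = (\<lambda>x. if x \<in> S then f x else 0)"
    have sub: "{x. f' x \<noteq> 0} \<subseteq> S" by (auto simp: f'_def)
    have f': "f' \<in> fin_supp" using finite_subset[OF sub S] by (simp add: fin_supp_def)
    have "0 \<le> form w {x. f' x \<noteq> 0} f' f'" using H f' frac_lap_form[OF f', of w] by auto
    also have "\<dots> = form w S f' f'" using sub S by (intro form_mono_neutral[symmetric]) auto
    also have "\<dots> = form w S f f" by (simp add: form_def f'_def cong: sum.cong)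
    finally show "0 \<le> form w S f f" .
  next
    fix f :: "int \<Rightarrow> real"
    assume H: "\<forall>S f. finite S \<longrightarrow> 0 \<le> form w S f f" and f: "f \<in> fin_supp"
    then have "0 \<le> form w {x. f x \<noteq> 0} f f" unfolding fin_supp_def by blast
    then show "ell2_inner (frac_lap \<sigma> f) f \<ge> ell2_inner (\<lambda>x. w x * f x) f"
      unfolding frac_lap_form[OF f, symmetric] by linarith
  qed
  then show ?thesis unfolding hardy_weight_def by blast
qed

lemma hardy_w_opt: "hardy_weight \<sigma> (w_opt \<sigma>)"
  unfolding hardy_weight_iff
proof (intro conjI allI impI)
  show "\<exists>x. w_opt \<sigma> x \<noteq> 0" using w_pos[of 0] by (intro exI[of _ 0]) linarith
qed (rule less_imp_le[OF w_pos], rule hardy_of_solution[OF sol])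

lemma critical_w_opt: "critical \<sigma> (w_opt \<sigma>)"
  unfolding critical_def
proof (intro conjI allI impI hardy_w_opt)
  fix w' assume "hardy_weight \<sigma> w' \<and> (\<forall>x. w_opt \<sigma> x \<le> w' x)"
  then show "w' = w_opt \<sigma>" by (intro weight_maximal) (auto simp: hardy_weight_iff)
qed

lemma frac_dom_iff: "u \<in> frac_dom \<sigma> \<longleftrightarrow> (\<lambda>x. \<bar>u x\<bar> * decay_weight x) summable_on UNIV"
  by (simp add: frac_dom_def decay_weight_def)

text \<open>
  Peetre's inequality \<open>1 + \<bar>y\<bar> \<le> (1 + \<bar>x\<bar>) (1 + \<bar>x - y\<bar>)\<close> shows that the kernel centred at
  \<open>x\<close> is dominated by the weight of the domain, so the two parts of
  \<open>\<kappa>(x - y) (u x - u y)\<close> may be summed separately.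
\<close>

lemma frac_lap_ext_eq:
  assumes u: "u \<in> frac_dom \<sigma>"
  shows "((\<lambda>y. a (x - y) * u y) has_sum frac_lap_ext \<sigma> u x) UNIV"
proof -
  obtain K where K: "K \<ge> 0" "\<And>x. \<bar>a x\<bar> \<le> K * decay_weight x" using a_bound by blast
  define D where "D = (1 + \<bar>real_of_int x\<bar>) powr (1 + 2 * \<sigma>)"
  have decay_weight: "decay_weight (x - y) \<le> D * decay_weight y" for y
  proof -
    have le: "1 + \<bar>real_of_int y\<bar> \<le> (1 + \<bar>real_of_int x\<bar>) * (1 + \<bar>real_of_int (x - y)\<bar>)"
    proof -
      have "\<bar>real_of_int y\<bar> \<le> \<bar>real_of_int x\<bar> + \<bar>real_of_int (x - y)\<bar>" by simp
      moreover have "0 \<le> \<bar>real_of_int x\<bar> * \<bar>real_of_int (x - y)\<bar>" by simp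
      ultimately show ?thesis
        unfolding distrib_left distrib_right mult_1_left mult_1_right by linarith
    qed
    have "(1 + \<bar>real_of_int y\<bar>) powr (1 + 2 * \<sigma>) \<le> ((1 + \<bar>real_of_int x\<bar>) * (1 + \<bar>real_of_int (x - y)\<bar>)) powr (1 + 2 * \<sigma>)"
      by (rule powr_mono2[OF _ _ le]) (use sigma_pos in auto)
    also have "\<dots> = D * (1 + \<bar>real_of_int (x - y)\<bar>) powr (1 + 2 * \<sigma>)"
      by (simp add: D_def powr_mult)
    finally have *: "(1 + \<bar>real_of_int y\<bar>) powr (1 + 2 * \<sigma>) \<le> D * (1 + \<bar>real_of_int (x - y)\<bar>) powr (1 + 2 * \<sigma>)" .
    have w: "decay_weight z = 1 / (1 + \<bar>real_of_int z\<bar>) powr (1 + 2 * \<sigma>)" for z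
      using powr_minus_divide[of "1 + \<bar>real_of_int z\<bar>" "1 + 2 * \<sigma>"] by (simp add: decay_weight_def)
    have p: "0 < (1 + \<bar>real_of_int z\<bar>) powr (1 + 2 * \<sigma>)" for z by simp
    show ?thesis unfolding w using * p[of "x - y"] p[of y] by (simp add: pos_divide_le_eq pos_le_divide_eq mult.commute)
  qed
  have "(\<lambda>y. K * D * (\<bar>u y\<bar> * decay_weight y)) summable_on UNIV"
    using u unfolding frac_dom_iff by (rule summable_on_cmult_right)
  then have "(\<lambda>y. norm (a (x - y) * u y)) summable_on UNIV"
  proof (rule summable_on_comparison_test)
    fix y
    have "\<bar>a (x - y)\<bar> \<le> K * (D * decay_weight y)" using K(2)[of "x - y"] mult_left_mono[OF decay_weight[of y] K(1)] by simp
    then have "\<bar>a (x - y)\<bar> * \<bar>u y\<bar> \<le> K * (D * decay_weight y) * \<bar>u y\<bar>" by (intro mult_right_mono) auto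
    then show "norm (a (x - y) * u y) \<le> K * D * (\<bar>u y\<bar> * decay_weight y)" by (simp add: abs_mult mult_ac)
  qed simp
  then have sm: "(\<lambda>y. a (x - y) * u y) summable_on UNIV" by (rule abs_summable_summable)
  have "((\<lambda>y. a (x - y)) has_sum 0) UNIV"
    using a_sum_zero by (subst has_sum_reindex_bij_witness[of UNIV "\<lambda>y. x - y" "\<lambda>y. x - y" UNIV a]) auto
  from has_sum_add[OF has_sum_infsum[OF sm] has_sum_cmult_left[OF this, of "- u x"]]
  have "((\<lambda>y. a (x - y) * u y + a (x - y) * (- u x)) has_sum (\<Sum>\<^sub>\<infinity>y. a (x - y) * u y)) UNIV" by simp
  moreover have "a (x - y) * u y + a (x - y) * (- u x) = frac_kernel \<sigma> (x - y) * (u x - u y)" for y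
    using frac_kernel_eq[of \<sigma> "x - y"] sigma_pos sigma_less_half by (cases "x = y") (auto simp: algebra_simps)
  ultimately have "((\<lambda>y. frac_kernel \<sigma> (x - y) * (u x - u y)) has_sum (\<Sum>\<^sub>\<infinity>y. a (x - y) * u y)) UNIV"
    by simp
  then have "frac_lap_ext \<sigma> u x = (\<Sum>\<^sub>\<infinity>y. a (x - y) * u y)"
    unfolding frac_lap_ext_def by (rule infsumI)
  then show ?thesis using has_sum_infsum[OF sm] by simp
qed

lemma psi_ground_state: "agmon_ground_state \<sigma> (w_opt \<sigma>) \<psi>"
proof -
  have "(\<lambda>x. \<psi> 0 * decay_weight x) summable_on UNIV" by (intro summable_on_cmult_right decay_weight_summable)
  then have d: "\<psi> \<in> frac_dom \<sigma>" unfolding frac_dom_iff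
    by (rule summable_on_comparison_test) (use decr[of 0] psi_positive decay_weight_pos in \<open>auto simp: less_imp_le intro!: mult_right_mono\<close>)
  moreover have "frac_lap_ext \<sigma> \<psi> x = w_opt \<sigma> x * \<psi> x" for x
    using has_sum_unique[OF frac_lap_ext_eq[OF d] a_psi] by (simp add: w_psi)
  ultimately show ?thesis by (simp add: agmon_ground_state_def psi_positive)
qed

lemma ground_state_solution:
  "agmon_ground_state \<sigma> (w_opt \<sigma>) u \<Longrightarrow> solution (w_opt \<sigma>) u"
  unfolding agmon_ground_state_def solution_def
  using frac_lap_ext_eq[of u] by (metis eq_iff_diff_eq_0)

lemma psi_not_summable: "\<not> (\<lambda>x. (\<psi> x)\<^sup>2 * w_opt \<sigma> x) summable_on UNIV"
proof
  assume "(\<lambda>x. (\<psi> x)\<^sup>2 * w_opt \<sigma> x) summable_on UNIV"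
  then have "(\<lambda>x. (\<psi> x)\<^sup>2 * w_opt \<sigma> x) summable_on range int" by (rule summable_on_subset) auto
  then have "(\<lambda>n. (\<psi> (int n))\<^sup>2 * w_opt \<sigma> (int n)) summable_on UNIV"
    by (subst (asm) summable_on_reindex) (auto simp: o_def)
  moreover have "(\<psi> (int n))\<^sup>2 * w_opt \<sigma> (int n) = mass n" for n
    using w_psi[of "int n"] by (simp add: mass_def power2_eq_square mult_ac)
  ultimately have "summable mass"
    using mass_pos by (simp add: summable_on_UNIV_nonneg_real_iff less_imp_le)
  then have "summable (\<lambda>n. mass (Suc n))" by (subst summable_Suc_iff)
  moreover have "norm (mass 1 * (1 / real (Suc n))) \<le> mass (Suc n)" for n
    using mass_lower[of n] mass_pos[of 1] by (simp add: field_simps del: of_nat_Suc)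
  ultimately have "summable (\<lambda>n. mass 1 * (1 / real (Suc n)))"
    by (rule summable_comparison_test'[of _ 0])
  then have "summable (\<lambda>n. 1 / real (Suc n))" using mass_pos[of 1] by (elim summable_mult_D) linarith
  then show False
    using not_summable_harmonic[where 'a=real] summable_Suc_iff[of "\<lambda>n. 1 / real n"] by (simp add: inverse_eq_divide)
qed

lemma null_critical_w_opt: "null_critical \<sigma> (w_opt \<sigma>)"
  unfolding null_critical_def
proof (intro conjI allI impI critical_w_opt exI[of _ \<psi>] psi_ground_state)
  fix u assume u: "agmon_ground_state \<sigma> (w_opt \<sigma>) u"
  define c where "c = u 0 / \<psi> 0"
  have c: "c > 0" using u psi_positive[of 0] by (simp add: c_def agmon_ground_state_def)
  have "u = (\<lambda>x. c * \<psi> x)"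
    unfolding c_def by (rule ext, rule solution_unique[OF ground_state_solution[OF u]])
  then have "(\<lambda>x. (u x)\<^sup>2 * w_opt \<sigma> x) = (\<lambda>x. c\<^sup>2 * ((\<psi> x)\<^sup>2 * w_opt \<sigma> x))"
    by (simp add: power_mult_distrib mult.assoc)
  then show "\<not> (\<lambda>x. (u x)\<^sup>2 * w_opt \<sigma> x) summable_on UNIV"
    using psi_not_summable c by (simp add: summable_on_cmult_right')
qed

end

theorem theorem1:
  fixes \<sigma> :: real
  assumes "0 < \<sigma>" and "\<sigma> < 1 / 2"
  shows "(\<forall>x. 0 < w_opt \<sigma> x) \<and> optimal_hardy_weight \<sigma> (w_opt \<sigma>)"
proof -
  interpret fractional_order \<sigma> using assms by unfold_locales
  show ?thesis using w_pos hardy_w_opt critical_w_opt null_critical_w_opt by (simp add: optimal_hardy_weight_def)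
qed

end
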